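(* Let $p$ be a separable permutation and let $f:[\mathbb{N}]^2\to 2$ be a computable coloring which avoids $p$. Then every 2-random set computes an infinite $f$-homogeneous set.
   Context: $[\mathbb{N}]^2$ is the set of pairs $x<y$ of naturals. A pattern of size $\ell$ is a function $p:[\ell]^2\to2$; a permutation $\pi$ of $\{0,\dots,\ell-1\}$ is identified with the pattern $p_\pi(x,y)=0$ if $\pi(x)<\pi(y)$ and $1$ otherwise ($x<y$). A finite set $\{x_0<\dots<x_{\ell-1}\}$ $f$-realizes $p$ if $f(x_i,x_j)=p(i,j)$ for all $i<j$; $f$ avoids $p$ if no finite subset of $\mathbb{N}$ $f$-realizes $p$. A set $H$ is $f$-homogeneous if $f$ is constant on pairs from $H$. Direct sum: $(\pi\oplus\sigma)(x)=\pi(x)$ for $x<m$, $\sigma(x-m)+m$ for $m\le x<m+n$; skew sum: $(\pi\ominus\sigma)(x)=\pi(x)+n$ for $x<m$, $\sigma(x-m)$ for $m\le x<m+n$ (with $m,n$ the sizes of $\pi,\sigma$). A permutation is separable if it is obtained from the one-element permutation by direct and skew sums. A set is 2-random if it is Martin-Löf random relative to $\emptyset'$, i.e. it lies outside $\bigcap_n\mathcal{U}_n$ for every uniform sequence $(\mathcal{U}_n)$ of $\Sigma^0_1(\emptyset')$ classes with Lebesgue measure $\mu(\mathcal{U}_n)\le 2^{-n}$. *)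

theory Defs
  imports "HOL-Probability.Probability" "HOL-Library.Nat_Bijection" "HOL-Combinatorics.Permutations"
begin

section \<open>Relative computability\<close>

text \<open>
  Programs for the partial functions on the natural numbers that are recursive relative to a set
  \<open>A\<close>. All programs are unary; several arguments are passed through the Cantor pairing function
  \<^const>\<open>prod_encode\<close>. The instruction \<open>Query\<close> is the characteristic function of \<open>A\<close>.
\<close>

datatype prog =
    Zero | Succ | Fst | Snd | Query
  | Pairing prog prog
  | Comp prog prog
  | Prec prog prog
  | Mu prog

text \<open>
  \<open>run A c n\<close> is the value of the program \<open>c\<close> with query set \<open>A\<close> on input \<open>n\<close>, and is \<^const>\<open>None\<close>
  if the computation diverges. Minimisation is the usual partial one: \<open>Mu c\<close> requires \<open>c\<close> to converge
  to a nonzero value at every argument below the returned one.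
\<close>

primrec run :: "nat set \<Rightarrow> prog \<Rightarrow> nat \<Rightarrow> nat option" where
  "run A Zero = (\<lambda>n. Some 0)"
| "run A Succ = (\<lambda>n. Some (Suc n))"
| "run A Fst = (\<lambda>n. Some (fst (prod_decode n)))"
| "run A Snd = (\<lambda>n. Some (snd (prod_decode n)))"
| "run A Query = (\<lambda>n. Some (if n \<in> A then 1 else 0))"
| "run A (Pairing c d) = (\<lambda>n.
     Option.bind (run A c n) (\<lambda>a. Option.bind (run A d n) (\<lambda>b. Some (prod_encode (a, b)))))"
| "run A (Comp c d) = (\<lambda>n. Option.bind (run A d n) (run A c))"
| "run A (Prec c d) = (\<lambda>n. case prod_decode n of (a, k) \<Rightarrow>
     rec_nat (run A c a)
       (\<lambda>i r. Option.bind r (\<lambda>v. run A d (prod_encode (a, prod_encode (i, v))))) k)"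
| "run A (Mu c) = (\<lambda>n.
     if \<exists>k. run A c (prod_encode (n, k)) = Some 0 \<and>
            (\<forall>i<k. \<exists>v. run A c (prod_encode (n, i)) = Some (Suc v))
     then Some (LEAST k. run A c (prod_encode (n, k)) = Some 0)
     else None)"

primrec godel :: "prog \<Rightarrow> nat" where
  "godel Zero = prod_encode (0, 0)"
| "godel Succ = prod_encode (1, 0)"
| "godel Fst = prod_encode (2, 0)"
| "godel Snd = prod_encode (3, 0)"
| "godel Query = prod_encode (4, 0)"
| "godel (Pairing c d) = prod_encode (5, prod_encode (godel c, godel d))"
| "godel (Comp c d) = prod_encode (6, prod_encode (godel c, godel d))"
| "godel (Prec c d) = prod_encode (7, prod_encode (godel c, godel d))"
| "godel (Mu c) = prod_encode (8, godel c)"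

lemma inj_godel: "inj godel"
proof (rule injI)
  fix c d
  show "godel c = godel d \<Longrightarrow> c = d"
  proof (induction c arbitrary: d)
    case Zero then show ?case by (cases d) auto
  next
    case Succ then show ?case by (cases d) auto
  next
    case Fst then show ?case by (cases d) auto
  next
    case Snd then show ?case by (cases d) auto
  next
    case Query then show ?case by (cases d) auto
  next
    case Pairing then show ?case by (cases d) auto
  next
    case Comp then show ?case by (cases d) auto
  next
    case Prec then show ?case by (cases d) auto
  next
    case Mu then show ?case by (cases d) auto
  qed
qed

text \<open>The halting problem \<open>\<emptyset>'\<close>.\<close>

definition zero_jump :: "nat set" where
  "zero_jump = {godel c | c. run {} c (godel c) \<noteq> None}"

definition computes :: "nat set \<Rightarrow> nat set \<Rightarrow> bool" where
  "computes X Y \<longleftrightarrow> (\<exists>c. \<forall>n. run X c n = Some (if n \<in> Y then 1 else 0))"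

definition ce_in :: "nat set \<Rightarrow> nat set \<Rightarrow> bool" where
  "ce_in A W \<longleftrightarrow> (\<exists>c. W = {n. run A c n \<noteq> None})"


section \<open>Algorithmic randomness\<close>

text \<open>
  Points of Cantor space are represented as sets of natural numbers. The Lebesgue (fair coin) measure
  lives on characteristic functions, so a class of sets is transported along \<^const>\<open>Collect\<close>.
\<close>

definition coin_measure :: "(nat \<Rightarrow> bool) measure" where
  "coin_measure = (\<Pi>\<^sub>M i\<in>UNIV. measure_pmf (bernoulli_pmf (1/2)))"

definition class_measure :: "nat set set \<Rightarrow> real" where
  "class_measure \<U> = measure coin_measure {x. Collect x \<in> \<U>}"

definition init_seg :: "nat set \<Rightarrow> nat \<Rightarrow> nat list" where
  "init_seg X k = map (\<lambda>i. if i \<in> X then 1 else 0) [0..<k]"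

text \<open>
  A uniform sequence of \<open>\<Sigma>\<^sup>0\<^sub>1(A)\<close> classes: \<open>\<U> n\<close> is the union of the cylinders given by the \<open>n\<close>-th
  section of a single \<open>A\<close>-c.e. set of (codes of) binary strings.
\<close>

definition uniformly_sigma01 :: "nat set \<Rightarrow> (nat \<Rightarrow> nat set set) \<Rightarrow> bool" where
  "uniformly_sigma01 A \<U> \<longleftrightarrow> (\<exists>W. ce_in A W \<and>
     (\<forall>n. \<U> n = {X. \<exists>k. prod_encode (n, list_encode (init_seg X k)) \<in> W}))"

definition martin_lof_random_rel :: "nat set \<Rightarrow> nat set \<Rightarrow> bool" where
  "martin_lof_random_rel A X \<longleftrightarrow>
     (\<forall>\<U>. uniformly_sigma01 A \<U> \<and> (\<forall>n. class_measure (\<U> n) \<le> (1/2) ^ n) \<longrightarrow> X \<notin> (\<Inter>n. \<U> n))"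

definition two_random :: "nat set \<Rightarrow> bool" where
  "two_random X \<longleftrightarrow> martin_lof_random_rel zero_jump X"

text \<open>
  Not immediate from the definition: the classes being measured are measurable, so \<^const>\<open>measure\<close>
  never returns its default value 0 on them.
\<close>

lemma measurable_init_seg: "{x. init_seg (Collect x) k = s} \<in> sets coin_measure"
proof -
  let ?M = "\<lambda>i::nat. measure_pmf (bernoulli_pmf (1/2))"
  have space: "space coin_measure = UNIV"
    by (simp add: coin_measure_def space_PiM)
  have coord: "{x. x i = b} \<in> sets coin_measure" for i and b :: bool
  proof -
    have "(\<lambda>x. x i) \<in> measurable coin_measure (?M i)"
      unfolding coin_measure_def by (rule measurable_component_singleton) simp
    from measurable_sets[OF this, of "{b}"] show ?thesis
      by (simp add: space vimage_def)
  qed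
  show ?thesis
  proof (cases "length s = k")
    case False
    then have "{x. init_seg (Collect x) k = s} = {}"
      by (auto simp: init_seg_def)
    then show ?thesis by simp
  next
    case True
    have "{x. init_seg (Collect x) k = s} =
        {x \<in> space coin_measure. \<forall>i\<in>{..<k}. (if x i then 1 else 0) = s ! i}"
      using True by (auto simp: init_seg_def list_eq_iff_nth_eq space)
    also have "\<dots> \<in> sets coin_measure"
    proof (rule sets.sets_Collect_finite_All)
      fix i
      have "{x \<in> space coin_measure. (if x i then 1 else 0) = s ! i} =
          (if s ! i = 1 then {x. x i = True} else if s ! i = 0 then {x. x i = False} else {})"
        by (auto simp: space)
      then show "{x \<in> space coin_measure. (if x i then 1 else 0) = s ! i} \<in> sets coin_measure"
        using coord[of i True] coord[of i False] by simp
    qed simp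
    finally show ?thesis .
  qed
qed

lemma measurable_uniformly_sigma01:
  assumes "uniformly_sigma01 A \<U>"
  shows "{x. Collect x \<in> \<U> n} \<in> sets coin_measure"
proof -
  from assms obtain W
    where "\<U> n = {X. \<exists>k. prod_encode (n, list_encode (init_seg X k)) \<in> W}"
    unfolding uniformly_sigma01_def by blast
  then have "{x. Collect x \<in> \<U> n} =
      (\<Union>k. \<Union>s\<in>{s. prod_encode (n, list_encode s) \<in> W}. {x. init_seg (Collect x) k = s})"
    by auto
  also have "\<dots> \<in> sets coin_measure"
    by (intro sets.countable_UN' measurable_init_seg countableI_type)
       (auto intro!: sets.countable_UN' measurable_init_seg countableI_type)
  finally show ?thesis .
qed


section \<open>Colorings and patterns\<close>

text \<open>
  Colorings of \<open>[\<nat>]\<^sup>2\<close> and patterns on \<open>[l]\<^sup>2\<close> are binary functions of which only the values at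
  \<open>x < y\<close> (respectively \<open>i < j < l\<close>) matter.
\<close>

definition coloring :: "(nat \<Rightarrow> nat \<Rightarrow> nat) \<Rightarrow> bool" where
  "coloring f \<longleftrightarrow> (\<forall>x y. x < y \<longrightarrow> f x y \<in> {0, 1})"

definition computable_coloring :: "(nat \<Rightarrow> nat \<Rightarrow> nat) \<Rightarrow> bool" where
  "computable_coloring f \<longleftrightarrow> (\<exists>c. \<forall>x y. x < y \<longrightarrow> run {} c (prod_encode (x, y)) = Some (f x y))"

definition realizes :: "(nat \<Rightarrow> nat \<Rightarrow> nat) \<Rightarrow> nat set \<Rightarrow> nat \<Rightarrow> (nat \<Rightarrow> nat \<Rightarrow> nat) \<Rightarrow> bool" where
  "realizes f F l p \<longleftrightarrow> finite F \<and> card F = l \<and>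
     (\<forall>i j. i < j \<and> j < l \<longrightarrow>
        f (sorted_list_of_set F ! i) (sorted_list_of_set F ! j) = p i j)"

definition avoids :: "(nat \<Rightarrow> nat \<Rightarrow> nat) \<Rightarrow> nat \<Rightarrow> (nat \<Rightarrow> nat \<Rightarrow> nat) \<Rightarrow> bool" where
  "avoids f l p \<longleftrightarrow> \<not> (\<exists>F. realizes f F l p)"

definition homogeneous :: "(nat \<Rightarrow> nat \<Rightarrow> nat) \<Rightarrow> nat set \<Rightarrow> bool" where
  "homogeneous f H \<longleftrightarrow> (\<exists>c. \<forall>x\<in>H. \<forall>y\<in>H. x < y \<longrightarrow> f x y = c)"


section \<open>Separable permutations\<close>

definition perm_pattern :: "(nat \<Rightarrow> nat) \<Rightarrow> nat \<Rightarrow> nat \<Rightarrow> nat" where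
  "perm_pattern \<pi> x y = (if \<pi> x < \<pi> y then 0 else 1)"

text \<open>
  A permutation of size \<open>m\<close> is a function on \<^typ>\<open>nat\<close> that permutes \<open>{..<m}\<close>; in particular it is
  the identity outside \<open>{..<m}\<close>. Both sums take the sizes \<open>m\<close>, \<open>n\<close> of the summands.
\<close>

definition direct_sum :: "nat \<Rightarrow> (nat \<Rightarrow> nat) \<Rightarrow> nat \<Rightarrow> (nat \<Rightarrow> nat) \<Rightarrow> nat \<Rightarrow> nat" where
  "direct_sum m \<pi> n \<sigma> x =
     (if x < m then \<pi> x else if x < m + n then \<sigma> (x - m) + m else x)"

definition skew_sum :: "nat \<Rightarrow> (nat \<Rightarrow> nat) \<Rightarrow> nat \<Rightarrow> (nat \<Rightarrow> nat) \<Rightarrow> nat \<Rightarrow> nat" where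
  "skew_sum m \<pi> n \<sigma> x =
     (if x < m then \<pi> x + n else if x < m + n then \<sigma> (x - m) else x)"

inductive separable :: "nat \<Rightarrow> (nat \<Rightarrow> nat) \<Rightarrow> bool" where
  one: "separable 1 id"
| direct: "separable m \<pi> \<Longrightarrow> separable n \<sigma> \<Longrightarrow> separable (m + n) (direct_sum m \<pi> n \<sigma>)"
| skew: "separable m \<pi> \<Longrightarrow> separable n \<sigma> \<Longrightarrow> separable (m + n) (skew_sum m \<pi> n \<sigma>)"

lemma permutes_lessThanI:
  assumes "\<And>x. x < l \<Longrightarrow> g x < l" and "inj_on g {..<l}" and "\<And>x. x \<ge> l \<Longrightarrow> g x = (x::nat)"
  shows "g permutes {..<l}"
proof (rule bij_imp_permutes)
  have "g ` {..<l} = {..<l}"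
    using assms by (intro endo_inj_surj) auto
  then show "bij_betw g {..<l} {..<l}"
    using assms(2) by (simp add: bij_betw_def)
qed (use assms(3) in auto)

lemma separable_permutes: "separable l \<pi> \<Longrightarrow> \<pi> permutes {..<l}"
proof (induction rule: separable.induct)
  case one
  show ?case by (rule permutes_id)
next
  case (direct m \<pi> n \<sigma>)
  have b: "\<And>x. x < m \<Longrightarrow> \<pi> x < m" "\<And>x. x < n \<Longrightarrow> \<sigma> x < n"
    using permutes_in_image[OF direct.IH(1)] permutes_in_image[OF direct.IH(2)] by auto
  have i: "\<And>x y. \<pi> x = \<pi> y \<Longrightarrow> x = y" "\<And>x y. \<sigma> x = \<sigma> y \<Longrightarrow> x = y"
    using permutes_inj[OF direct.IH(1)] permutes_inj[OF direct.IH(2)] by (auto dest: injD)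
  show ?case
  proof (rule permutes_lessThanI)
    show "direct_sum m \<pi> n \<sigma> x < m + n" if "x < m + n" for x
      using that b(1)[of x] b(2)[of "x - m"] by (auto simp: direct_sum_def)
    show "inj_on (direct_sum m \<pi> n \<sigma>) {..<m + n}"
    proof (rule inj_onI)
      fix x y assume "x \<in> {..<m + n}" "y \<in> {..<m + n}" "direct_sum m \<pi> n \<sigma> x = direct_sum m \<pi> n \<sigma> y"
      then show "x = y"
        using b(1)[of x] b(1)[of y] i(1)[of x y] i(2)[of "x - m" "y - m"]
        by (auto simp: direct_sum_def split: if_splits)
    qed
  qed (simp add: direct_sum_def)
next
  case (skew m \<pi> n \<sigma>)
  have b: "\<And>x. x < m \<Longrightarrow> \<pi> x < m" "\<And>x. x < n \<Longrightarrow> \<sigma> x < n"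
    using permutes_in_image[OF skew.IH(1)] permutes_in_image[OF skew.IH(2)] by auto
  have i: "\<And>x y. \<pi> x = \<pi> y \<Longrightarrow> x = y" "\<And>x y. \<sigma> x = \<sigma> y \<Longrightarrow> x = y"
    using permutes_inj[OF skew.IH(1)] permutes_inj[OF skew.IH(2)] by (auto dest: injD)
  have b': "\<sigma> (x - m) < n" if "x < m + n" "\<not> x < m" for x
    using that by (intro b(2)) simp
  show ?case
  proof (rule permutes_lessThanI)
    show "skew_sum m \<pi> n \<sigma> x < m + n" if "x < m + n" for x
      using that b(1)[of x] b'[of x] by (auto simp: skew_sum_def)
    show "inj_on (skew_sum m \<pi> n \<sigma>) {..<m + n}"
    proof (rule inj_onI)
      fix x y assume "x \<in> {..<m + n}" "y \<in> {..<m + n}" "skew_sum m \<pi> n \<sigma> x = skew_sum m \<pi> n \<sigma> y"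
      then show "x = y"
        using b'[of x] b'[of y] i(1)[of x y] i(2)[of "x - m" "y - m"]
        by (auto simp: skew_sum_def split: if_splits)
    qed
  qed (simp add: skew_sum_def)
qed

end

theory Submission
  imports Defs
begin

text \<open>
  Call a coloring pattern a tree of depth \<open>d\<close> and arity \<open>N\<close> if it is the \<open>N\<close>-fold direct or skew sum of
  trees of depth \<open>d - 1\<close>, with the two kinds of sum alternating along the levels. Every separable
  permutation embeds in all binary trees of sufficient depth, so \<open>f\<close> omits some tree on \<open>\<nat>\<close>. Choose a depth
  \<open>d + 1\<close> minimal such that some computable infinite set omits a tree of this depth, and then a computable
  infinite \<open>R\<close> that omits \<open>j + 1\<close> successive trees of depth \<open>d\<close> joined in color \<open>c\<close>, with \<open>j\<close>
  minimal. All computable infinite sets then contain all trees of depth \<open>d\<close>.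

  Build a homogeneous set of color \<open>a = 1 - c\<close> point by point, always keeping to the computable set of
  those points of \<open>R\<close> that are joined in color \<open>a\<close> to everything chosen so far. A point is a dead end if this
  set becomes finite. By minimality of \<open>j\<close> the dead ends contain no \<open>k\<close>-ary tree of depth \<open>d\<close>, so they have
  density at most \<open>d k / N\<close> in any \<open>N\<close>-ary one. Hence one finds an \<open>N\<close>-ary tree with \<open>N\<close> huge and picks
  one of its points by fresh random bits. Being trapped by a dead end is a \<open>\<Sigma>\<^sup>0\<^sub>1(\<emptyset>')\<close> event, and its
  probability can be made at most \<open>2\<^sup>-\<^sup>c\<close>, uniformly in \<open>c\<close>.
\<close>

section \<open>Relative recursiveness\<close>

abbreviation pfst :: "nat \<Rightarrow> nat" where "pfst n \<equiv> fst (prod_decode n)"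
abbreviation psnd :: "nat \<Rightarrow> nat" where "psnd n \<equiv> snd (prod_decode n)"

definition recursive_in :: "nat set \<Rightarrow> (nat \<Rightarrow> nat) \<Rightarrow> bool" where
  "recursive_in A f \<longleftrightarrow> (\<exists>c. \<forall>n. run A c n = Some (f n))"

definition decidable_in :: "nat set \<Rightarrow> (nat \<Rightarrow> bool) \<Rightarrow> bool" where
  "decidable_in A P \<longleftrightarrow> recursive_in A (\<lambda>n. if P n then 1 else 0)"

section \<open>Closure properties of recursive functions and decidable predicates\<close>

lemma recursive_in_Suc:
  assumes "recursive_in A f" shows "recursive_in A (\<lambda>n. Suc (f n))"
proof -
  from assms obtain c where "\<And>n. run A c n = Some (f n)" unfolding recursive_in_def by blast
  then have "\<forall>n. run A (Comp Succ c) n = Some (Suc (f n))" by simp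
  then show ?thesis unfolding recursive_in_def by blast
qed

lemma recursive_in_const: "recursive_in A (\<lambda>_. k)"
proof (induction k)
  case 0
  have "\<forall>n. run A Zero n = Some 0" by simp
  then show ?case unfolding recursive_in_def by blast
qed (rule recursive_in_Suc)

lemma recursive_in_comp:
  assumes "recursive_in A f" "recursive_in A g" shows "recursive_in A (\<lambda>n. f (g n))"
proof -
  from assms obtain c d where "\<And>n. run A c n = Some (f n)" "\<And>n. run A d n = Some (g n)"
    unfolding recursive_in_def by blast
  then have "\<forall>n. run A (Comp c d) n = Some (f (g n))" by simp
  then show ?thesis unfolding recursive_in_def by blast
qed

lemma recursive_in_pair:
  assumes "recursive_in A f" "recursive_in A g"
  shows "recursive_in A (\<lambda>n. prod_encode (f n, g n))"
proof -
  from assms obtain c d where "\<And>n. run A c n = Some (f n)" "\<And>n. run A d n = Some (g n)"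
    unfolding recursive_in_def by blast
  then have "\<forall>n. run A (Pairing c d) n = Some (prod_encode (f n, g n))" by simp
  then show ?thesis unfolding recursive_in_def by blast
qed

lemma recursive_in_pfst:
  assumes "recursive_in A f" shows "recursive_in A (\<lambda>n. pfst (f n))"
proof -
  have "\<forall>n. run A Fst n = Some (pfst n)" by simp
  then have "recursive_in A pfst" unfolding recursive_in_def by blast
  then show ?thesis using assms by (rule recursive_in_comp)
qed

lemma recursive_in_psnd:
  assumes "recursive_in A f" shows "recursive_in A (\<lambda>n. psnd (f n))"
proof -
  have "\<forall>n. run A Snd n = Some (psnd n)" by simp
  then have "recursive_in A psnd" unfolding recursive_in_def by blast
  then show ?thesis using assms by (rule recursive_in_comp)
qed

lemma recursive_in_id: "recursive_in A (\<lambda>n. n)"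
proof -
  have "\<forall>n. run A (Pairing Fst Snd) n = Some n" by simp
  then show ?thesis unfolding recursive_in_def by blast
qed

lemma decidable_in_oracle:
  assumes "recursive_in A f" shows "decidable_in A (\<lambda>n. f n \<in> A)"
proof -
  have "\<forall>n. run A Query n = Some (if n \<in> A then 1 else 0)" by simp
  then have "recursive_in A (\<lambda>n. if n \<in> A then 1 else 0)" unfolding recursive_in_def by blast
  then show ?thesis unfolding decidable_in_def using assms by (rule recursive_in_comp)
qed

text \<open>
  The only argument of a function codes the values of all its free variables. Binding a further variable
  \<open>x\<close> in the context \<open>n\<close> yields the context \<open>m = prod_encode (n, x)\<close>, which explains the shape of the premises
  below.
\<close>

lemma recursive_in_rec_nat:
  assumes "recursive_in A a" "recursive_in A k"
    and "recursive_in A (\<lambda>m. h (pfst m) (pfst (psnd m)) (psnd (psnd m)))"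
  shows "recursive_in A (\<lambda>n. rec_nat (a n) (h n) (k n))"
proof -
  from assms obtain ca ck ch where c: "\<And>n. run A ca n = Some (a n)" "\<And>n. run A ck n = Some (k n)"
    "\<And>m. run A ch m = Some (h (pfst m) (pfst (psnd m)) (psnd (psnd m)))"
    unfolding recursive_in_def by metis
  have "rec_nat (Some (a n)) (\<lambda>i r. Option.bind r (\<lambda>v. run A ch (prod_encode (n, prod_encode (i, v))))) j
      = Some (rec_nat (a n) (h n) j)" for n j
    by (induction j) (auto simp: c)
  then have "\<forall>n. run A (Comp (Prec ca ch) (Pairing (Pairing Fst Snd) ck)) n =
      Some (rec_nat (a n) (h n) (k n))"
    by (simp add: c)
  then show ?thesis unfolding recursive_in_def by blast
qed

lemmas recursive_in_basic = recursive_in_id recursive_in_const recursive_in_Suc recursive_in_pair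
  recursive_in_pfst recursive_in_psnd recursive_in_rec_nat

lemma recursive_in_pred:
  assumes "recursive_in A f" shows "recursive_in A (\<lambda>n. f n - 1)"
proof -
  have "k - 1 = rec_nat 0 (\<lambda>i _. i) k" for k :: nat
    by (cases k) simp_all
  then show ?thesis by (simp only:) (intro recursive_in_basic assms)
qed

lemma recursive_in_add:
  assumes "recursive_in A f" "recursive_in A g" shows "recursive_in A (\<lambda>n. f n + g n)"
proof -
  have "j + k = rec_nat j (\<lambda>_ r. Suc r) k" for j k :: nat
    by (induction k) simp_all
  then show ?thesis by (simp only:) (intro recursive_in_basic assms)
qed

lemma recursive_in_diff:
  assumes "recursive_in A f" "recursive_in A g" shows "recursive_in A (\<lambda>n. f n - g n)"
proof -
  have "j - k = rec_nat j (\<lambda>_ r. r - 1) k" for j k :: nat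
    by (induction k) simp_all
  \<comment> \<open>Instantiated, because the right-hand side contains a subtraction again and the
    general equation would rewrite forever.\<close>
  then have "f n - g n = rec_nat (f n) (\<lambda>_ r. r - 1) (g n)" for n .
  then show ?thesis by (simp only:) (intro recursive_in_basic recursive_in_pred assms)
qed

lemma recursive_in_mult:
  assumes "recursive_in A f" "recursive_in A g" shows "recursive_in A (\<lambda>n. f n * g n)"
proof -
  have "j * k = rec_nat 0 (\<lambda>_ r. r + j) k" for j k :: nat
    by (induction k) simp_all
  then show ?thesis
    by (simp only:) (intro recursive_in_basic recursive_in_add recursive_in_comp[OF assms(1)] assms)
qed

lemma recursive_in_power:
  assumes "recursive_in A f" "recursive_in A g" shows "recursive_in A (\<lambda>n. f n ^ g n)"
proof -
  have "j ^ k = rec_nat 1 (\<lambda>_ r. r * j) k" for j k :: nat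
    by (induction k) simp_all
  then show ?thesis
    by (simp only:) (intro recursive_in_basic recursive_in_mult recursive_in_comp[OF assms(1)] assms)
qed

lemma recursive_in_funpow:
  assumes "recursive_in A h" "recursive_in A f" "recursive_in A g"
  shows "recursive_in A (\<lambda>n. (h ^^ g n) (f n))"
proof -
  have "(h ^^ k) j = rec_nat j (\<lambda>_ r. h r) k" for j k :: nat
    by (induction k) simp_all
  then show ?thesis
    by (simp only:) (intro recursive_in_basic recursive_in_comp[OF assms(1)] assms)
qed

lemma recursive_in_if:
  assumes "decidable_in A P" "recursive_in A f" "recursive_in A g"
  shows "recursive_in A (\<lambda>n. if P n then f n else g n)"
proof -
  have "(if P n then f n else g n) = rec_nat (g n) (\<lambda>_ _. f n) (if P n then 1 else 0)" for n
    by simp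
  then show ?thesis using assms unfolding decidable_in_def
    by (simp only:) (intro recursive_in_basic recursive_in_comp[OF assms(2)] assms)
qed

lemma decidable_in_less:
  assumes "recursive_in A f" "recursive_in A g" shows "decidable_in A (\<lambda>n. f n < g n)"
proof -
  have "(if j < k then 1 else 0) = 1 - (1 - (k - j))" for j k :: nat by simp
  then show ?thesis
    unfolding decidable_in_def by (simp only:) (intro recursive_in_basic recursive_in_diff assms)
qed

lemma decidable_in_not:
  assumes "decidable_in A P" shows "decidable_in A (\<lambda>n. \<not> P n)"
proof -
  have "(if \<not> P n then 1 else 0) = (if P n then 0 else 1::nat)" for n by simp
  then show ?thesis
    unfolding decidable_in_def by (simp only:) (intro recursive_in_if assms recursive_in_basic)
qed

lemma decidable_in_conj:
  assumes "decidable_in A P" "decidable_in A Q" shows "decidable_in A (\<lambda>n. P n \<and> Q n)"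
proof -
  have "recursive_in A (\<lambda>n. if P n then if Q n then 1 else 0 else 0)"
    by (intro recursive_in_if assms recursive_in_basic)
  moreover have "(if P n then if Q n then 1 else 0 else 0) = (if P n \<and> Q n then 1 else 0::nat)" for n
    by simp
  ultimately show ?thesis by (simp only: decidable_in_def)
qed

lemma decidable_in_le:
  assumes "recursive_in A f" "recursive_in A g" shows "decidable_in A (\<lambda>n. f n \<le> g n)"
  using decidable_in_not[OF decidable_in_less[OF assms(2,1)]] by (simp add: not_less)

lemma decidable_in_eq:
  assumes "recursive_in A f" "recursive_in A g" shows "decidable_in A (\<lambda>n. f n = g n)"
  using decidable_in_conj[OF decidable_in_le[OF assms] decidable_in_le[OF assms(2,1)]]
  by (simp add: eq_iff)

lemma decidable_in_comp:
  assumes "decidable_in A P" "recursive_in A g" shows "decidable_in A (\<lambda>n. P (g n))"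
  using assms unfolding decidable_in_def by (rule recursive_in_comp)

lemma recursive_in_comp2:
  assumes "recursive_in A (\<lambda>m. h (pfst m) (psnd m))" "recursive_in A f" "recursive_in A g"
  shows "recursive_in A (\<lambda>n. h (f n) (g n))"
  using recursive_in_comp[OF assms(1) recursive_in_pair[OF assms(2,3)]] by simp

lemma decidable_in_comp2:
  assumes "decidable_in A (\<lambda>m. P (pfst m) (psnd m))" "recursive_in A f" "recursive_in A g"
  shows "decidable_in A (\<lambda>n. P (f n) (g n))"
  using decidable_in_comp[OF assms(1) recursive_in_pair[OF assms(2,3)]] by simp

lemma decidable_in_all_less:
  assumes "decidable_in A (\<lambda>m. P (pfst m) (psnd m))" "recursive_in A k"
  shows "decidable_in A (\<lambda>n. \<forall>i<k n. P n i)"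
proof -
  have eq: "(if \<forall>i<j. P n i then 1 else 0) = rec_nat (1::nat) (\<lambda>i r. if P n i then r else 0) j" for n j
    by (induction j) (auto simp: less_Suc_eq)
  have P: "decidable_in A (\<lambda>m. P (pfst m) (pfst (psnd m)))"
    by (rule decidable_in_comp2[OF assms(1)]) (intro recursive_in_basic)+
  show ?thesis unfolding decidable_in_def eq
    by (intro recursive_in_basic recursive_in_if assms P)
qed

lemma decidable_in_const: "decidable_in A (\<lambda>_. b)"
  unfolding decidable_in_def by (rule recursive_in_const)

section \<open>Unbounded search\<close>

lemma run_Mu_decidable:
  assumes "\<And>m. run A c m = Some (if P (pfst m) (psnd m) then 0 else 1)"
  shows "run A (Mu c) n = (if \<exists>k. P n k then Some (LEAST k. P n k) else None)"
proof -
  \<comment> \<open>The test converges everywhere, so the condition on smaller arguments only says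
    that \<open>k\<close> is the first witness.\<close>
  have "(\<exists>k. run A c (prod_encode (n, k)) = Some 0 \<and>
            (\<forall>i<k. \<exists>v. run A c (prod_encode (n, i)) = Some (Suc v))) \<longleftrightarrow> (\<exists>k. P n k)"
    by (auto simp: assms split: if_splits) (metis exists_least_iff)
  then show ?thesis by (simp add: assms)
qed

lemma decidable_in_flip_program:
  assumes "decidable_in A P"
  shows "\<exists>c. \<forall>m. run A c m = Some (if P m then 0 else 1)"
  using recursive_in_if[OF assms recursive_in_const recursive_in_const] unfolding recursive_in_def .

lemma recursive_in_Least:
  assumes "decidable_in A (\<lambda>m. P (pfst m) (psnd m))" "\<And>n. \<exists>k. P n k"
  shows "recursive_in A (\<lambda>n. LEAST k. P n k)"
proof -
  obtain c where "\<And>m. run A c m = Some (if P (pfst m) (psnd m) then 0 else 1)"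
    using decidable_in_flip_program[OF assms(1)] by blast
  from run_Mu_decidable[of A c P, OF this] have "\<forall>n. run A (Mu c) n = Some (LEAST k. P n k)"
    using assms(2) by simp
  then show ?thesis unfolding recursive_in_def by blast
qed

lemma ce_in_ex:
  assumes "decidable_in A (\<lambda>m. P (pfst m) (psnd m))"
  shows "ce_in A {n. \<exists>k. P n k}"
proof -
  obtain c where "\<And>m. run A c m = Some (if P (pfst m) (psnd m) then 0 else 1)"
    using decidable_in_flip_program[OF assms(1)] by blast
  from run_Mu_decidable[of A c P, OF this] have "{n. \<exists>k. P n k} = {n. run A (Mu c) n \<noteq> None}"
    by auto
  then show ?thesis unfolding ce_in_def by blast
qed

section \<open>Programs without queries and the halting problem\<close>

primrec erase_queries :: "prog \<Rightarrow> prog" where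
  "erase_queries Zero = Zero"
| "erase_queries Succ = Succ"
| "erase_queries Fst = Fst"
| "erase_queries Snd = Snd"
| "erase_queries Query = Zero"
| "erase_queries (Pairing c d) = Pairing (erase_queries c) (erase_queries d)"
| "erase_queries (Comp c d) = Comp (erase_queries c) (erase_queries d)"
| "erase_queries (Prec c d) = Prec (erase_queries c) (erase_queries d)"
| "erase_queries (Mu c) = Mu (erase_queries c)"

text \<open>The empty oracle answers 0 to every query, just like \<open>Zero\<close>. Hence
  computations relative to \<open>{}\<close> carry over to any \<open>A\<close>.\<close>

lemma run_erase_queries: "run A (erase_queries c) = run {} c"
  by (induction c) (simp_all cong: if_cong)

lemma recursive_in_mono:
  assumes "recursive_in {} f" shows "recursive_in A f"
proof -
  from assms obtain c where "\<forall>n. run {} c n = Some (f n)" unfolding recursive_in_def by blast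
  then have "\<forall>n. run A (erase_queries c) n = Some (f n)" by (simp add: run_erase_queries)
  then show ?thesis unfolding recursive_in_def by blast
qed

lemma decidable_in_mono:
  assumes "decidable_in {} P" shows "decidable_in A P"
  using assms unfolding decidable_in_def by (rule recursive_in_mono)

text \<open>Composing with \<open>const_prog n\<close> fixes the argument of a program to
  \<open>n\<close>, in the role of the s-m-n theorem.\<close>

primrec const_prog :: "nat \<Rightarrow> prog" where
  "const_prog 0 = Zero"
| "const_prog (Suc n) = Comp Succ (const_prog n)"

lemma run_const_prog: "run A (const_prog n) m = Some n"
  by (induction n) simp_all

lemma recursive_in_godel_const_prog: "recursive_in A (\<lambda>n. godel (const_prog n))"
proof -
  have "godel (const_prog n) =
      rec_nat (godel Zero) (\<lambda>_ r. prod_encode (6, prod_encode (godel Succ, r))) n" for n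
    by (induction n) simp_all
  then show ?thesis by (simp only:) (intro recursive_in_basic)
qed

text \<open>The oracle is asked whether the search for \<open>k\<close> halts. Since
  \<open>zero_jump\<close> runs programs on their own code, the query concerns a program that
  ignores its input and searches in the fixed context \<open>n\<close>.\<close>

lemma decidable_in_zero_jump_ex:
  assumes "decidable_in {} (\<lambda>m. P (pfst m) (psnd m))"
  shows "decidable_in zero_jump (\<lambda>n. \<exists>k. P n k)"
proof -
  obtain c where "\<And>m. run {} c m = Some (if P (pfst m) (psnd m) then 0 else 1)"
    using decidable_in_flip_program[OF assms(1)] by blast
  note mu = run_Mu_decidable[of "{}" c P, OF this]
  define g where "g n = godel (Comp (Mu c) (const_prog n))" for n
  have "g n \<in> zero_jump \<longleftrightarrow> run {} (Mu c) n \<noteq> None" for n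
    by (auto simp: zero_jump_def g_def run_const_prog injD[OF inj_godel] simp del: godel.simps run.simps(9)
        dest!: injD[OF inj_godel])
  then have "g n \<in> zero_jump \<longleftrightarrow> (\<exists>k. P n k)" for n
    by (simp add: mu del: run.simps)
  moreover have "recursive_in zero_jump g"
    unfolding g_def godel.simps by (intro recursive_in_basic recursive_in_godel_const_prog)
  ultimately show ?thesis
    using decidable_in_oracle[of zero_jump g] by simp
qed

section \<open>Codes of lists and finite sets\<close>

definition tail_code :: "nat \<Rightarrow> nat" where
  "tail_code e = psnd (e - 1)"

text \<open>\<open>list_encode (x # xs)\<close> is the successor of the pair of \<open>x\<close> and
  \<open>list_encode xs\<close>; hence the \<open>- 1\<close> before projecting.\<close>

definition nth_code :: "nat \<Rightarrow> nat \<Rightarrow> nat" where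
  "nth_code e i = pfst ((tail_code ^^ i) e - 1)"

lemma funpow_tail_code: "(tail_code ^^ i) (list_encode xs) = list_encode (drop i xs)"
proof (induction i arbitrary: xs)
  case (Suc i)
  \<comment> \<open>The empty list has code 0, and \<open>tail_code 0\<close> must again be 0 to
    match \<open>tl [] = []\<close>.\<close>
  have "prod_decode 0 = (0, 0)"
    using prod_encode_inverse[of "(0, 0)"] by (simp add: prod_encode_def)
  then have "tail_code (list_encode ys) = list_encode (tl ys)" for ys
    by (cases ys) (simp_all add: tail_code_def)
  then show ?case by (simp add: Suc drop_Suc drop_tl)
qed simp

lemma nth_code_list_encode:
  assumes "i < length xs" shows "nth_code (list_encode xs) i = xs ! i"
proof -
  have "drop i xs = xs ! i # drop (Suc i) xs" using Cons_nth_drop_Suc[OF assms] ..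
  then show ?thesis unfolding nth_code_def funpow_tail_code by (simp only: list_encode.simps) simp
qed

lemma recursive_in_tail_code: "recursive_in A tail_code"
  unfolding tail_code_def by (intro recursive_in_basic recursive_in_pred)

lemma recursive_in_nth_code:
  assumes "recursive_in A f" "recursive_in A g"
  shows "recursive_in A (\<lambda>n. nth_code (f n) (g n))"
  unfolding nth_code_def
  by (intro recursive_in_basic recursive_in_pred recursive_in_funpow recursive_in_tail_code assms)

text \<open>Only the empty list has code 0, so a search for the first exhausted tail finds the
  length.\<close>

lemma length_list_decode_Least:
  "length (list_decode e) = (LEAST i. (tail_code ^^ i) e = 0)"
proof -
  obtain xs where e: "e = list_encode xs" by (metis list_decode_inverse)
  have "list_encode ys = 0 \<longleftrightarrow> ys = []" for ys by (cases ys) auto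
  then have "(tail_code ^^ i) e = 0 \<longleftrightarrow> length xs \<le> i" for i
    by (simp add: e funpow_tail_code)
  then show ?thesis by (auto simp: e intro!: Least_equality[symmetric])
qed

lemma recursive_in_length_list_decode:
  assumes "recursive_in A f"
  shows "recursive_in A (\<lambda>n. length (list_decode (f n)))"
proof -
  have "recursive_in A (\<lambda>e. LEAST i. (tail_code ^^ i) e = 0)"
  proof (rule recursive_in_Least)
    show "decidable_in A (\<lambda>m. (tail_code ^^ psnd m) (pfst m) = 0)"
      by (intro decidable_in_eq recursive_in_funpow recursive_in_tail_code recursive_in_basic)
    show "\<exists>i. (tail_code ^^ i) e = 0" for e
      using funpow_tail_code[of "length (list_decode e)" "list_decode e"] by auto
  qed
  then have "recursive_in A (\<lambda>e. length (list_decode e))"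
    by (simp only: length_list_decode_Least)
  then show ?thesis using assms by (rule recursive_in_comp)
qed

lemma decidable_in_Ball_list_decode:
  assumes "decidable_in A (\<lambda>m. P (pfst m) (psnd m))" "recursive_in A f"
  shows "decidable_in A (\<lambda>n. \<forall>x\<in>set (list_decode (f n)). P n x)"
proof -
  have "(\<forall>x\<in>set (list_decode e). P n x) \<longleftrightarrow>
      (\<forall>i<length (list_decode e). P n (nth_code e i))" for n e
    using nth_code_list_encode[of _ "list_decode e"] by (auto simp: all_set_conv_all_nth)
  then show ?thesis
    by (simp only:) (intro decidable_in_all_less decidable_in_comp2[OF assms(1)] recursive_in_nth_code
      recursive_in_basic recursive_in_comp[OF assms(2)] recursive_in_length_list_decode assms(2))
qed

lemma recursive_in_set_encode:
  assumes "decidable_in A (\<lambda>m. P (pfst m) (psnd m))" "recursive_in A k"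
  shows "recursive_in A (\<lambda>n. set_encode {j. j < k n \<and> P n j})"
proof -
  have eq: "set_encode {j. j < m \<and> P n j} = rec_nat 0 (\<lambda>j r. if P n j then r + 2 ^ j else r) m" for n m
  proof (induction m)
    case (Suc m)
    have "{j. j < Suc m \<and> P n j} = (if P n m then insert m {j. j < m \<and> P n j} else {j. j < m \<and> P n j})"
      by (auto simp: less_Suc_eq)
    then show ?case using Suc by (simp add: set_encode_insert)
  qed simp
  show ?thesis unfolding eq
    by (intro recursive_in_basic recursive_in_if recursive_in_add recursive_in_power
      decidable_in_comp2[OF assms(1)] assms(2))
qed

lemma recursive_in_sum:
  assumes "recursive_in A (\<lambda>m. h (pfst m) (psnd m))" "recursive_in A k"
  shows "recursive_in A (\<lambda>n. \<Sum>i<k n. h n i)"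
proof -
  have eq: "(\<Sum>i<m. h n i) = rec_nat 0 (\<lambda>i r. r + h n i) m" for n m
    by (induction m) simp_all
  show ?thesis unfolding eq
    by (intro recursive_in_basic recursive_in_add recursive_in_comp2[OF assms(1)] assms(2))
qed

lemma computable_coloring_total:
  assumes "computable_coloring f"
  obtains g where "recursive_in {} (\<lambda>m. g (pfst m) (psnd m))" "\<And>x y. x < y \<Longrightarrow> g x y = f x y"
proof -
  obtain c where c: "\<And>x y. x < y \<Longrightarrow> run {} c (prod_encode (x, y)) = Some (f x y)"
    using assms unfolding computable_coloring_def by blast
  \<comment> \<open>The program \<open>c\<close> may diverge unless \<open>x < y\<close>, so it is only ever run on such pairs.\<close>
  define g where "g x y = f x (Suc x + (y - Suc x))" for x y
  define u where "u m = prod_encode (pfst m, Suc (pfst m) + (psnd m - Suc (pfst m)))" for m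
  have "recursive_in {} u" unfolding u_def
    by (intro recursive_in_basic recursive_in_add recursive_in_diff)
  then obtain d where d: "\<And>n. run {} d n = Some (u n)" unfolding recursive_in_def by blast
  have "\<forall>m. run {} (Comp c d) m = Some (g (pfst m) (psnd m))"
    by (simp add: d u_def c g_def)
  then have "recursive_in {} (\<lambda>m. g (pfst m) (psnd m))" unfolding recursive_in_def by blast
  moreover have "g x y = f x y" if "x < y" for x y using that by (simp add: g_def)
  ultimately show thesis using that by blast
qed

section \<open>Alternating trees\<close>

text \<open>\<open>P\<close> and \<open>j\<close> are independent of the block size
  \<open>M\<close>, so that one notion covers both a full tree level and an incomplete row of
  \<open>j\<close> trees joined in one color.\<close>

definition blocks ::
  "(nat \<Rightarrow> nat \<Rightarrow> nat) \<Rightarrow> nat \<Rightarrow> nat \<Rightarrow> ((nat \<Rightarrow> nat) \<Rightarrow> bool) \<Rightarrow> nat \<Rightarrow> (nat \<Rightarrow> nat) \<Rightarrow> bool" where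
  "blocks f j M P c g \<longleftrightarrow> (\<forall>i<j. P (\<lambda>x. g (i * M + x))) \<and>
     (\<forall>i'<j. \<forall>i<i'. \<forall>x<M. \<forall>y<M.
        g (i * M + x) < g (i' * M + y) \<and> f (g (i * M + x)) (g (i' * M + y)) = c)"

text \<open>
  \<open>g 0 < \<dots> < g (N ^ d - 1)\<close> realizes the tree of depth \<open>d\<close> and arity \<open>N\<close> with color \<open>c\<close> at the root; the
  values of \<open>g\<close> from \<open>N ^ d\<close> on are irrelevant.
\<close>

primrec tree_copy :: "(nat \<Rightarrow> nat \<Rightarrow> nat) \<Rightarrow> nat \<Rightarrow> nat \<Rightarrow> nat \<Rightarrow> (nat \<Rightarrow> nat) \<Rightarrow> bool" where
  "tree_copy f N 0 = (\<lambda>c g. True)"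
| "tree_copy f N (Suc d) = (\<lambda>c. blocks f N (N ^ d) (tree_copy f N d (1 - c)) c)"

text \<open>The depth is a fixed number, so induction on it suffices. \<open>N\<close> and
  \<open>g\<close> are generalized because a block reads them in a context with one more
  variable.\<close>

lemma decidable_in_tree_copy:
  assumes f: "recursive_in A (\<lambda>m. f (pfst m) (psnd m))"
    and "recursive_in A N" "recursive_in A (\<lambda>m. g (pfst m) (psnd m))"
  shows "decidable_in A (\<lambda>n. tree_copy f (N n) d c (g n))"
  using assms(2,3)
proof (induction d arbitrary: c N g)
  case 0
  show ?case by (simp add: decidable_in_const)
next
  case (Suc d)
  note g = recursive_in_comp2[OF Suc.prems(2)] and N = recursive_in_comp[OF Suc.prems(1)]
  note rec = recursive_in_basic g N recursive_in_add recursive_in_mult recursive_in_power Suc.prems(1)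
    recursive_in_comp2[OF f]
  show ?case unfolding tree_copy.simps blocks_def
    by (intro decidable_in_conj decidable_in_all_less decidable_in_less decidable_in_eq rec Suc.IH)
qed

lemma block_index_less:
  fixes M :: nat
  assumes "i < j" "x < M" shows "i * M + x < j * M"
proof -
  have "i * M + x < Suc i * M" using assms(2) by simp
  also have "\<dots> \<le> j * M" using assms(1) by (intro mult_le_mono1) simp
  finally show ?thesis .
qed

lemma tree_copy_cong:
  assumes "\<And>i. i < N ^ d \<Longrightarrow> g i = h i"
  shows "tree_copy f N d c g \<longleftrightarrow> tree_copy f N d c h"
  using assms
proof (induction d arbitrary: c g h)
  case (Suc d)
  have eq: "g (i * N ^ d + x) = h (i * N ^ d + x)" if "i < N" "x < N ^ d" for i x
    using Suc.prems block_index_less[OF that] by simp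
  have "tree_copy f N d c' (\<lambda>x. g (i * N ^ d + x)) \<longleftrightarrow> tree_copy f N d c' (\<lambda>x. h (i * N ^ d + x))"
    if "i < N" for i c'
    by (rule Suc.IH) (rule eq[OF that])
  then show ?case by (auto simp: blocks_def eq)
qed simp

text \<open>Pieces \<open>h i\<close> taken from distinct blocks inherit order and color from these
  blocks. Quotient and remainder by \<open>K\<close> concatenate them.\<close>

lemma blocks_select:
  fixes s :: "nat \<Rightarrow> nat"
  assumes g: "blocks f N M P' c g" and s: "\<And>i. i < k \<Longrightarrow> s i < N" "\<And>i j. i < j \<Longrightarrow> j < k \<Longrightarrow> s i < s j"
    and h: "\<And>i. i < k \<Longrightarrow> P (h i)"
      "\<And>i x. i < k \<Longrightarrow> x < K \<Longrightarrow> h i x \<in> (\<lambda>y. g (s i * M + y)) ` {..<M}"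
    and cong: "\<And>u v. (\<And>i. i < K \<Longrightarrow> u i = v i) \<Longrightarrow> P u \<longleftrightarrow> P v"
  shows "blocks f k K P c (\<lambda>x. h (x div K) (x mod K))"
proof -
  have "P (\<lambda>x. h ((i * K + x) div K) ((i * K + x) mod K))" if "i < k" for i
    using h(1)[OF that] by (subst cong[of _ "h i"]) auto
  moreover have "h i x < h i' y \<and> f (h i x) (h i' y) = c" if "i < i'" "i' < k" "x < K" "y < K" for i i' x y
  proof -
    have "i < k" using that by simp
    obtain x' y' where "h i x = g (s i * M + x')" "x' < M" "h i' y = g (s i' * M + y')" "y' < M"
      using h(2)[OF \<open>i < k\<close> \<open>x < K\<close>] h(2)[OF \<open>i' < k\<close> \<open>y < K\<close>] by auto
    then show ?thesis using g s(1)[of i'] s(2)[of i i'] that unfolding blocks_def by auto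
  qed
  ultimately show ?thesis unfolding blocks_def by auto
qed

text \<open>
  At each level fewer than \<open>k\<close> of the \<open>N\<close> subtrees can contain a \<open>k\<close>-ary tree inside \<open>B\<close>; this costs a
  fraction \<open>k / N\<close> per level.
\<close>

lemma tree_copy_density:
  assumes "tree_copy f N d c g" "B \<subseteq> {..<N ^ d}"
    and "\<not> (\<exists>h. tree_copy f k d c h \<and> h ` {..<k ^ d} \<subseteq> g ` B)"
  shows "N * card B \<le> d * k * N ^ d"
  using assms
proof (induction d arbitrary: c g B)
  case 0
  \<comment> \<open>At depth 0 any single point is a \<open>k\<close>-ary tree.\<close>
  have "B = {}"
  proof (rule ccontr)
    assume "B \<noteq> {}"
    then obtain b where "b \<in> B" by blast
    then show False using "0.prems"(3) by (auto dest!: spec[of _ "\<lambda>_. g b"])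
  qed
  then show ?case by simp
next
  case (Suc d)
  let ?M = "N ^ d"
  define B' where "B' i = {x. x < ?M \<and> i * ?M + x \<in> B}" for i
  define g' where "g' i x = g (i * ?M + x)" for i x
  \<comment> \<open>The heavy subtrees: those with a \<open>k\<close>-ary tree inside
    \<open>B\<close>.\<close>
  define I where "I = {i. i < N \<and> (\<exists>h. tree_copy f k d (1 - c) h \<and> h ` {..<k ^ d} \<subseteq> g' i ` B' i)}"
  have bl: "blocks f N ?M (tree_copy f N d (1 - c)) c g" using Suc.prems(1) by simp
  have B'fin: "finite (B' i)" "card (B' i) \<le> ?M" for i
    using card_mono[of "{..<?M}" "B' i"] by (auto simp: B'_def)
  have finI: "finite I" "I \<subseteq> {..<N}" by (auto simp: I_def)
  \<comment> \<open>The trees inside \<open>k\<close> heavy subtrees would combine to a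
    \<open>k\<close>-ary tree of depth \<open>Suc d\<close> inside \<open>B\<close>.\<close>
  have "card I < k"
  proof (rule ccontr)
    assume "\<not> card I < k"
    define s where "s i = sorted_list_of_set I ! i" for i
    have s: "s i \<in> I" if "i < k" for i
      using that \<open>\<not> card I < k\<close> nth_mem[of i "sorted_list_of_set I"] finI by (simp add: s_def)
    have smono: "s i < s j" if "i < j" "j < k" for i j
      using that \<open>\<not> card I < k\<close> strict_sorted_list_of_set[of I] finI
      by (auto simp: s_def sorted_wrt_iff_nth_less)
    have "\<forall>i. \<exists>h. i < k \<longrightarrow> tree_copy f k d (1 - c) h \<and> h ` {..<k ^ d} \<subseteq> g' (s i) ` B' (s i)"
      using s by (auto simp: I_def)
    then obtain h where h: "\<And>i. i < k \<Longrightarrow> tree_copy f k d (1 - c) (h i)"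
      "\<And>i. i < k \<Longrightarrow> h i ` {..<k ^ d} \<subseteq> g' (s i) ` B' (s i)" by metis
    have "blocks f k (k ^ d) (tree_copy f k d (1 - c)) c (\<lambda>x. h (x div k ^ d) (x mod k ^ d))"
    proof (rule blocks_select[OF bl, of k s])
      show "s i < N" if "i < k" for i using s[OF that] finI by auto
      show "h i x \<in> (\<lambda>y. g (s i * ?M + y)) ` {..<?M}" if "i < k" "x < k ^ d" for i x
        using h(2)[OF that(1)] that(2) by (fastforce simp: g'_def B'_def)
    qed (use smono h(1) in \<open>auto cong: tree_copy_cong\<close>)
    then have "tree_copy f k (Suc d) c (\<lambda>x. h (x div k ^ d) (x mod k ^ d))" by simp
    moreover have "(\<lambda>x. h (x div k ^ d) (x mod k ^ d)) ` {..<k ^ Suc d} \<subseteq> g ` B"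
    proof (rule image_subsetI)
      fix x assume x: "x \<in> {..<k ^ Suc d}"
      then have "k \<noteq> 0" by (cases k) auto
      then have "x div k ^ d < k" "x mod k ^ d < k ^ d"
        using x by (auto simp: less_mult_imp_div_less)
      from h(2)[OF this(1)] this(2) show "h (x div k ^ d) (x mod k ^ d) \<in> g ` B"
        by (fastforce simp: g'_def B'_def)
    qed
    ultimately show False using Suc.prems(3) by blast
  qed
  have light: "N * card (B' i) \<le> d * k * ?M" if "i \<in> {..<N} - I" for i
  proof (rule Suc.IH)
    show "tree_copy f N d (1 - c) (g' i)" using bl that by (simp add: blocks_def g'_def[abs_def])
    show "B' i \<subseteq> {..<?M}" by (auto simp: B'_def)
    show "\<not> (\<exists>h. tree_copy f k d (1 - c) h \<and> h ` {..<k ^ d} \<subseteq> g' i ` B' i)"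
      using that by (auto simp: I_def)
  qed
  have "B \<subseteq> (\<Union>i<N. (\<lambda>x. i * ?M + x) ` B' i)"
  proof
    fix b assume "b \<in> B"
    then have "b < N * ?M" using Suc.prems(2) by auto
    then have "b div ?M < N" "b mod ?M < ?M"
      by (auto simp: less_mult_imp_div_less intro!: mod_less_divisor gr0I)
    moreover have "b div ?M * ?M + b mod ?M = b" by (rule div_mult_mod_eq)
    ultimately have "b mod ?M \<in> B' (b div ?M)" using \<open>b \<in> B\<close>
      by (simp only: B'_def mem_Collect_eq)
    then have "b \<in> (\<lambda>x. (b div ?M) * ?M + x) ` B' (b div ?M)"
      by (rule image_eqI[rotated]) (rule div_mult_mod_eq[symmetric])
    then show "b \<in> (\<Union>i<N. (\<lambda>x. i * ?M + x) ` B' i)" using \<open>b div ?M < N\<close> by blast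
  qed
  then have "card B \<le> card (\<Union>i<N. (\<lambda>x. i * ?M + x) ` B' i)"
    by (intro card_mono) (auto simp: B'fin)
  also have "\<dots> \<le> (\<Sum>i<N. card ((\<lambda>x. i * ?M + x) ` B' i))"
    by (rule card_UN_le) simp
  also have "\<dots> \<le> (\<Sum>i<N. card (B' i))"
    by (intro sum_mono card_image_le B'fin)
  finally have "N * card B \<le> (\<Sum>i<N. N * card (B' i))" by (simp add: sum_distrib_left[symmetric])
  also have "\<dots> = (\<Sum>i\<in>I. N * card (B' i)) + (\<Sum>i\<in>{..<N} - I. N * card (B' i))"
    using sum.subset_diff[OF finI(2)] by (simp add: add.commute)
  \<comment> \<open>Heavy subtrees are counted in full, the others by the induction
    hypothesis.\<close>
  also have "\<dots> \<le> card I * (N * ?M) + card ({..<N} - I) * (d * k * ?M)"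
    using sum_bounded_above[of I "\<lambda>i. N * card (B' i)" "N * ?M"] light B'fin(2)
      sum_bounded_above[of "{..<N} - I" "\<lambda>i. N * card (B' i)" "d * k * ?M"]
    by (intro add_mono) simp_all
  also have "\<dots> \<le> k * (N * ?M) + N * (d * k * ?M)"
    using \<open>card I < k\<close> card_mono[of "{..<N}" "{..<N} - I"] by (intro add_mono mult_le_mono) auto
  also have "\<dots> = Suc d * k * N ^ Suc d" by (simp add: algebra_simps)
  finally show ?case .
qed

section \<open>Separable permutations in binary trees\<close>

definition embeds :: "(nat \<Rightarrow> nat \<Rightarrow> nat) \<Rightarrow> nat \<Rightarrow> (nat \<Rightarrow> nat \<Rightarrow> nat) \<Rightarrow> nat \<Rightarrow> nat \<Rightarrow> bool" where
  "embeds f l p d c \<longleftrightarrow> (\<forall>g. tree_copy f 2 d c g \<longrightarrow> (\<exists>u. (\<forall>i<l. u i \<in> g ` {..<2 ^ d}) \<and>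
     (\<forall>j<l. \<forall>i<j. u i < u j \<and> f (u i) (u j) = p i j)))"

lemma tree_copy_2_Suc:
  assumes "tree_copy f 2 (Suc d) c g"
  shows "tree_copy f 2 d (1 - c) g" "tree_copy f 2 d (1 - c) (\<lambda>x. g (2 ^ d + x))"
    "\<And>x y. x < 2 ^ d \<Longrightarrow> y < 2 ^ d \<Longrightarrow> g x < g (2 ^ d + y) \<and> f (g x) (g (2 ^ d + y)) = c"
  using assms by (auto simp: blocks_def numeral_2_eq_2 less_Suc_eq)

text \<open>The left subtree already has depth \<open>d\<close> and root color
  \<open>1 - c\<close>.\<close>

lemma embeds_Suc:
  assumes "embeds f l p d (1 - c)" shows "embeds f l p (Suc d) c"
  unfolding embeds_def
proof (intro allI impI)
  fix g assume "tree_copy f 2 (Suc d) c g"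
  then obtain u where u: "\<forall>i<l. u i \<in> g ` {..<2 ^ d}" "\<forall>j<l. \<forall>i<j. u i < u j \<and> f (u i) (u j) = p i j"
    using assms tree_copy_2_Suc(1) unfolding embeds_def by blast
  moreover have "g ` {..<2 ^ d} \<subseteq> g ` {..<2 ^ Suc d}" by auto
  ultimately show "\<exists>u. (\<forall>i<l. u i \<in> g ` {..<2 ^ Suc d}) \<and> (\<forall>j<l. \<forall>i<j. u i < u j \<and> f (u i) (u j) = p i j)"
    by blast
qed

text \<open>One summand goes into the left subtree and the other into the right one; the root colors
  all pairs between them.\<close>

lemma embeds_sum:
  assumes "embeds f m p d (1 - c)" "embeds f n p' d (1 - c)"
    and "\<And>i j. i < j \<Longrightarrow> j < m \<Longrightarrow> r i j = p i j"
    and "\<And>i j. i < j \<Longrightarrow> j < n \<Longrightarrow> r (m + i) (m + j) = p' i j"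
    and "\<And>i j. i < m \<Longrightarrow> j < n \<Longrightarrow> r i (m + j) = c"
  shows "embeds f (m + n) r (Suc d) c"
  unfolding embeds_def
proof (intro allI impI)
  fix g assume g: "tree_copy f 2 (Suc d) c g"
  let ?g = "\<lambda>x. g (2 ^ d + x)"
  obtain u where u: "\<And>i. i < m \<Longrightarrow> u i \<in> g ` {..<2 ^ d}"
    "\<And>i j. j < m \<Longrightarrow> i < j \<Longrightarrow> u i < u j \<and> f (u i) (u j) = p i j"
    using assms(1)[unfolded embeds_def, rule_format, OF tree_copy_2_Suc(1)[OF g]] by auto
  obtain v where v: "\<And>i. i < n \<Longrightarrow> v i \<in> ?g ` {..<2 ^ d}"
    "\<And>i j. j < n \<Longrightarrow> i < j \<Longrightarrow> v i < v j \<and> f (v i) (v j) = p' i j"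
    using assms(2)[unfolded embeds_def, rule_format, OF tree_copy_2_Suc(2)[OF g]] by auto
  have uv: "u i < v j \<and> f (u i) (v j) = c" if "i < m" "j < n" for i j
    using u(1)[OF that(1)] v(1)[OF that(2)] tree_copy_2_Suc(3)[OF g] by auto
  define w where "w i = (if i < m then u i else v (i - m))" for i
  have "w i \<in> g ` {..<2 ^ Suc d}" if "i < m + n" for i
  proof (cases "i < m")
    case True
    then show ?thesis using u(1)[of i] by (auto simp: w_def)
  next
    case False
    then have "i - m < n" using that by simp
    from v(1)[OF this] obtain x where "x < 2 ^ d" "w i = g (2 ^ d + x)"
      using False by (auto simp: w_def)
    then show ?thesis by (intro image_eqI) auto
  qed
  moreover have "w i < w j \<and> f (w i) (w j) = r i j" if "j < m + n" "i < j" for i j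
  proof (cases "j < m")
    case True
    then show ?thesis using u(2)[of j i] assms(3)[of i j] that by (simp add: w_def)
  next
    case False
    then obtain j' where j': "j = m + j'" "j' < n"
      using \<open>j < m + n\<close> by (intro that[of "j - m"]) simp_all
    show ?thesis
    proof (cases "i < m")
      case True
      then show ?thesis using uv[of i j'] assms(5)[of i j'] j' by (simp add: w_def)
    next
      case False
      then obtain i' where "i = m + i'" by (intro that[of "i - m"]) simp
      then show ?thesis using v(2)[of j' i'] assms(4)[of i' j'] j' that by (simp add: w_def)
    qed
  qed
  ultimately show "\<exists>u. (\<forall>i<m + n. u i \<in> g ` {..<2 ^ Suc d}) \<and>
      (\<forall>j<m + n. \<forall>i<j. u i < u j \<and> f (u i) (u j) = r i j)"
    by blast
qed

text \<open>If the root has the wrong color, descending one level flips it. This level and the one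
  consumed by the sum account for the two extra levels.\<close>

lemma embeds_sum_eventually:
  assumes "\<forall>d\<ge>d1. \<forall>c\<in>{0, 1}. embeds f m p d c" "\<forall>d\<ge>d2. \<forall>c\<in>{0, 1}. embeds f n p' d c"
    and "\<And>i j. i < j \<Longrightarrow> j < m \<Longrightarrow> r i j = p i j"
    and "\<And>i j. i < j \<Longrightarrow> j < n \<Longrightarrow> r (m + i) (m + j) = p' i j"
    and "\<And>i j. i < m \<Longrightarrow> j < n \<Longrightarrow> r i (m + j) = e" and "e \<in> {0, 1}"
  shows "\<exists>d0. \<forall>d\<ge>d0. \<forall>c\<in>{0, 1}. embeds f (m + n) r d c"
proof (intro exI allI impI ballI)
  fix d c :: nat assume d: "d \<ge> Suc (Suc (max d1 d2))" and c: "c \<in> {0, 1}"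
  have 1: "embeds f (m + n) r (Suc d') e" if "d' \<ge> max d1 d2" for d'
    using assms that by (intro embeds_sum[of f m p d' e n p' r]) auto
  obtain d' where d': "d = Suc (Suc d')" "d' \<ge> max d1 d2" using d by (metis Suc_le_D Suc_le_mono)
  show "embeds f (m + n) r d c"
  proof (cases "c = e")
    case True
    then show ?thesis using 1[of "Suc d'"] d' by simp
  next
    case False
    then have "1 - c = e" using c assms(6) by auto
    then show ?thesis using 1[of d'] d' embeds_Suc[of f "m + n" r "Suc d'" c] by simp
  qed
qed

text \<open>Asking for all large depths and both root colors makes the induction work: the two
  summands need a common depth, and colors alternate along the levels.\<close>

lemma separable_embeds:
  assumes "separable l \<pi>"
  shows "\<exists>d0. \<forall>d\<ge>d0. \<forall>c\<in>{0, 1}. embeds f l (perm_pattern \<pi>) d c"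
  using assms
proof induction
  case one
  have "\<exists>u. (\<forall>i<1. u i \<in> g ` {..<2 ^ d}) \<and> (\<forall>j<1. \<forall>i<j. u i < u j \<and> f (u i) (u j) = p i j)"
    for g :: "nat \<Rightarrow> nat" and d :: nat and p :: "nat \<Rightarrow> nat \<Rightarrow> nat"
    by (rule exI[of _ "\<lambda>_. g 0"]) auto
  then have "embeds f 1 (perm_pattern id) d c" for d c
    unfolding embeds_def by blast
  then show ?case by blast
next
  case (direct m \<pi> n \<sigma>)
  then obtain d1 d2 where d: "\<forall>d\<ge>d1. \<forall>c\<in>{0, 1}. embeds f m (perm_pattern \<pi>) d c"
    "\<forall>d\<ge>d2. \<forall>c\<in>{0, 1}. embeds f n (perm_pattern \<sigma>) d c" by blast
  have "\<pi> i < m" if "i < m" for i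
    using permutes_in_image[OF separable_permutes[OF direct.hyps(1)], of i] that by simp
  then show ?case
    by (intro embeds_sum_eventually[OF d, where e = 0])
      (auto simp: perm_pattern_def direct_sum_def trans_less_add2)
next
  case (skew m \<pi> n \<sigma>)
  then obtain d1 d2 where d: "\<forall>d\<ge>d1. \<forall>c\<in>{0, 1}. embeds f m (perm_pattern \<pi>) d c"
    "\<forall>d\<ge>d2. \<forall>c\<in>{0, 1}. embeds f n (perm_pattern \<sigma>) d c" by blast
  have "\<sigma> i < n" if "i < n" for i
    using permutes_in_image[OF separable_permutes[OF skew.hyps(2)], of i] that by simp
  then have "\<not> (\<pi> i + n < \<sigma> j)" if "j < n" for i j
    using that by (meson less_asym' not_add_less2 order.strict_trans)
  then show ?case
    by (intro embeds_sum_eventually[OF d, where e = 1])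
      (auto simp: perm_pattern_def skew_sum_def)
qed

lemma realizes_increasing:
  assumes "\<And>i j. j < l \<Longrightarrow> i < j \<Longrightarrow> u i < u j \<and> f (u i) (u j) = p i j"
  shows "realizes f (u ` {..<l}) l p"
proof -
  have "inj_on u {..<l}"
    using assms by (intro linorder_inj_onI) (auto, metis less_irrefl)
  then have card: "card (u ` {..<l}) = l" by (simp add: card_image)
  \<comment> \<open>An increasing \<open>u\<close> is itself the sorted enumeration of its
    image.\<close>
  have "sorted_wrt (<) (map u [0..<l])"
    using assms by (auto simp: sorted_wrt_iff_nth_less)
  then have "sorted_list_of_set (u ` {..<l}) = map u [0..<l]"
    using sorted_list_of_set.idem_if_sorted_distinct[of "map u [0..<l]"]
    by (simp add: strict_sorted_iff lessThan_atLeast0)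
  then show ?thesis unfolding realizes_def using card assms by auto
qed

lemma avoids_separable_no_tree_copy:
  assumes "separable l \<pi>" "avoids f l (perm_pattern \<pi>)"
  shows "\<exists>d. \<forall>g. \<not> tree_copy f 2 d 0 g"
proof -
  obtain d where "embeds f l (perm_pattern \<pi>) d 0" using separable_embeds[OF assms(1)] by blast
  then have "\<not> tree_copy f 2 d 0 g" for g
    using assms(2) realizes_increasing[of l _ f "perm_pattern \<pi>"]
    unfolding embeds_def avoids_def by meson
  then show ?thesis by blast
qed

section \<open>Random bits\<close>

interpretation coin: prob_space coin_measure
  unfolding coin_measure_def by (intro prob_space_PiM measure_pmf.prob_space_axioms)

lemma cylinder_coin_measure:
  assumes "S \<subseteq> {..<L}"
  shows "{x. Collect x \<inter> {..<L} = S} \<in> sets coin_measure"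
    and "measure coin_measure {x. Collect x \<inter> {..<L} = S} = (1 / 2) ^ L"
proof -
  let ?M = "\<lambda>i::nat. measure_pmf (bernoulli_pmf (1/2))"
  interpret product_prob_space ?M UNIV by unfold_locales
  have iff: "Collect x \<inter> {..<L} = S \<longleftrightarrow> (\<forall>i<L. x i \<longleftrightarrow> i \<in> S)" for x
    using assms by auto
  have "{x. Collect x \<inter> {..<L} = S} =
      {x. init_seg (Collect x) L = map (\<lambda>i. if i \<in> S then 1 else 0) [0..<L]}"
    unfolding iff init_seg_def by (auto split: if_splits)
  then show "{x. Collect x \<inter> {..<L} = S} \<in> sets coin_measure"
    using measurable_init_seg by simp
  have half: "emeasure (?M i) {b} = ennreal (1/2)" for i b
    by (cases b) (simp_all add: emeasure_pmf_single)
  have "{x. Collect x \<inter> {..<L} = S} = {x \<in> space (Pi\<^sub>M UNIV ?M). \<forall>i\<in>{..<L}. x i \<in> {i \<in> S}}"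
    unfolding iff by (auto simp: space_PiM)
  then have "emeasure coin_measure {x. Collect x \<inter> {..<L} = S} = (\<Prod>i<L. emeasure (?M i) {i \<in> S})"
    unfolding coin_measure_def by (simp only:) (rule emeasure_PiM_Collect, auto)
  also have "\<dots> = ennreal ((1 / 2) ^ L)" by (simp only: half prod_constant card_lessThan ennreal_power)
  finally show "measure coin_measure {x. Collect x \<inter> {..<L} = S} = (1 / 2) ^ L"
    by (simp add: measure_def)
qed

lemma coin_measure_finite_information:
  assumes "E \<subseteq> Pow {..<L}"
  shows "{x. Collect x \<inter> {..<L} \<in> E} \<in> sets coin_measure"
    and "measure coin_measure {x. Collect x \<inter> {..<L} \<in> E} = card E / 2 ^ L"
proof -
  have fin: "finite E" using assms by (rule finite_subset) simp
  have eq: "{x. Collect x \<inter> {..<L} \<in> E} = (\<Union>S\<in>E. {x. Collect x \<inter> {..<L} = S})" by auto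
  have sets: "{x. Collect x \<inter> {..<L} = S} \<in> sets coin_measure" if "S \<in> E" for S
    using that assms by (intro cylinder_coin_measure) auto
  show "{x. Collect x \<inter> {..<L} \<in> E} \<in> sets coin_measure"
    unfolding eq using fin sets by auto
  have "measure coin_measure (\<Union>S\<in>E. {x. Collect x \<inter> {..<L} = S}) =
      (\<Sum>S\<in>E. measure coin_measure {x. Collect x \<inter> {..<L} = S})"
    using sets by (intro coin.finite_measure_finite_Union fin) (auto simp: disjoint_family_on_def)
  also have "\<dots> = (\<Sum>S\<in>E. (1 / 2) ^ L)"
    using assms by (intro sum.cong refl cylinder_coin_measure) auto
  also have "\<dots> = card E / 2 ^ L" by (simp add: power_one_over divide_simps)
  finally show "measure coin_measure {x. Collect x \<inter> {..<L} \<in> E} = card E / 2 ^ L"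
    unfolding eq .
qed

lemma set_encode_less:
  assumes "A \<subseteq> {..<M}" shows "set_encode A < 2 ^ M"
proof -
  have "set_encode A \<le> set_encode {..<M}"
    unfolding set_encode_def using assms by (intro sum_mono2) auto
  also have "\<dots> < 2 ^ M" unfolding set_encode_def
    by (induction M) (simp_all add: lessThan_Suc)
  finally show ?thesis .
qed

text \<open>The bad values of the next \<open>M\<close> bits may depend on the first
  \<open>L\<close> bits. As at most \<open>B\<close> are bad for each past, the bound
  \<open>B / 2 ^ M\<close> survives averaging over the past.\<close>

lemma coin_measure_fresh_bits:
  fixes L M :: nat and B :: nat
  assumes "\<And>S. S \<subseteq> {..<L} \<Longrightarrow> card {v. v < 2 ^ M \<and> Q S v} \<le> B"
  defines "E \<equiv> {x. Q (Collect x \<inter> {..<L}) (set_encode {j. j < M \<and> x (L + j)})}"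
  shows "E \<in> sets coin_measure" and "measure coin_measure E \<le> B / 2 ^ M"
proof -
  define high where "high S = set_encode {j. j < M \<and> L + j \<in> S}" for S
  define T where "T = {S. S \<subseteq> {..<L + M} \<and> Q (S \<inter> {..<L}) (high S)}"
  have "(Collect x \<inter> {..<L + M}) \<inter> {..<L} = Collect x \<inter> {..<L}" for x by auto
  moreover have "high (Collect x \<inter> {..<L + M}) = set_encode {j. j < M \<and> x (L + j)}" for x
    unfolding high_def by (rule arg_cong[where f = set_encode]) auto
  ultimately have E: "E = {x. Collect x \<inter> {..<L + M} \<in> T}" by (simp add: E_def T_def)
  have T: "T \<subseteq> Pow {..<L + M}" by (auto simp: T_def)
  show "E \<in> sets coin_measure" unfolding E using T by (rule coin_measure_finite_information)
  \<comment> \<open>The low part and the code of the high part determine a set of bits, so counting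
    pairs bounds \<open>card T\<close>.\<close>
  have inj: "inj_on (\<lambda>S. (S \<inter> {..<L}, high S)) T"
  proof (rule inj_onI)
    fix S S' assume S: "S \<in> T" "S' \<in> T" "(S \<inter> {..<L}, high S) = (S' \<inter> {..<L}, high S')"
    then have hi: "{j. j < M \<and> L + j \<in> S} = {j. j < M \<and> L + j \<in> S'}"
      by (simp add: high_def set_encode_eq)
    have lo: "S \<inter> {..<L} = S' \<inter> {..<L}" using S(3) by simp
    have "i \<in> S \<longleftrightarrow> i \<in> S'" for i
    proof (cases "i < L + M")
      case True
      then show ?thesis
      proof (cases "i < L")
        case True then show ?thesis using lo by blast
      next
        case False
        then have "i - L < M" "L + (i - L) = i" using True by auto
        then show ?thesis using hi by (metis (mono_tags, lifting) mem_Collect_eq)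
      qed
    next
      case False then show ?thesis using S T by auto
    qed
    then show "S = S'" by blast
  qed
  have "(\<lambda>S. (S \<inter> {..<L}, high S)) ` T \<subseteq> (SIGMA S:Pow {..<L}. {v. v < 2 ^ M \<and> Q S v})"
    by (auto simp: T_def high_def intro!: set_encode_less)
  then have "card T \<le> card (SIGMA S:Pow {..<L}. {v. v < 2 ^ M \<and> Q S v})"
    using inj by (intro card_inj_on_le) auto
  also have "\<dots> = (\<Sum>S\<in>Pow {..<L}. card {v. v < 2 ^ M \<and> Q S v})" by (intro card_SigmaI) auto
  also have "\<dots> \<le> (\<Sum>S\<in>Pow {..<L}. B)" using assms(1) by (intro sum_mono) auto
  also have "\<dots> = 2 ^ L * B" by (simp add: card_Pow)
  finally have "real (card T) \<le> 2 ^ L * B" by (metis of_nat_le_iff of_nat_mult of_nat_numeral of_nat_power)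
  then show "measure coin_measure E \<le> B / 2 ^ M"
    unfolding E coin_measure_finite_information(2)[OF T] by (simp add: power_add field_simps)
qed

section \<open>Random homogeneous sets\<close>

definition reservoir :: "(nat \<Rightarrow> nat \<Rightarrow> nat) \<Rightarrow> nat \<Rightarrow> nat set \<Rightarrow> nat list \<Rightarrow> nat set" where
  "reservoir f a R D = {y \<in> R. \<forall>x\<in>set D. x < y \<and> f x y = a}"

lemma decidable_in_reservoir:
  assumes f: "recursive_in A (\<lambda>m. f (pfst m) (psnd m))" and R: "decidable_in A (\<lambda>y. y \<in> R)"
    and "recursive_in A D" "recursive_in A y"
  shows "decidable_in A (\<lambda>n. y n \<in> reservoir f a R (list_decode (D n)))"
  unfolding reservoir_def mem_Collect_eq
  by (intro decidable_in_conj decidable_in_comp[OF R] decidable_in_Ball_list_decode decidable_in_less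
    decidable_in_eq recursive_in_comp2[OF f] recursive_in_comp[OF assms(4)] recursive_in_basic assms(3,4))

locale random_walk =
  fixes f :: "nat \<Rightarrow> nat \<Rightarrow> nat" and R :: "nat set" and a d q :: nat
  assumes f: "recursive_in {} (\<lambda>m. f (pfst m) (psnd m))"
    and R: "decidable_in {} (\<lambda>y. y \<in> R)"
begin

text \<open>
  The \<open>n\<close>-th point of run \<open>c\<close> is drawn from a tree of arity \<open>arity c n\<close>, large enough for an error
  probability of \<open>2\<^sup>-\<^sup>n\<^sup>-\<^sup>c\<^sup>-\<^sup>1\<close> if \<open>2 ^ q\<close> is at least \<open>d * k\<close>, and a power of two so that the draw consumes exactly
  the \<open>exponent c n * d\<close> bits of the oracle starting at \<open>offset c n\<close>.
\<close>

definition exponent :: "nat \<Rightarrow> nat \<Rightarrow> nat" where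
  "exponent c n = q + n + c + 1"

definition arity :: "nat \<Rightarrow> nat \<Rightarrow> nat" where
  "arity c n = 2 ^ exponent c n"

definition offset :: "nat \<Rightarrow> nat \<Rightarrow> nat" where
  "offset c n = (\<Sum>i<n. exponent c i * d)"

definition choice :: "nat set \<Rightarrow> nat \<Rightarrow> nat \<Rightarrow> nat" where
  "choice X c n = set_encode {j. j < exponent c n * d \<and> offset c n + j \<in> X}"

definition accepts :: "nat \<Rightarrow> nat \<Rightarrow> nat list \<Rightarrow> bool" where
  "accepts c e D \<longleftrightarrow> tree_copy f (arity c (length D)) d a (nth_code e) \<and>
     (\<forall>i<arity c (length D) ^ d. nth_code e i \<in> reservoir f a R D)"

text \<open>
  At time \<open>t\<close> only the candidate \<open>pfst t\<close> is tried, so that the walk is total; every candidate comes up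
  infinitely often. The points chosen so far are listed in decreasing order.
\<close>

primrec walk :: "nat set \<Rightarrow> nat \<Rightarrow> nat \<Rightarrow> nat list" where
  "walk X c 0 = []"
| "walk X c (Suc t) = (let D = walk X c t in
     if accepts c (pfst t) D then nth_code (pfst t) (choice X c (length D)) # D else D)"

lemma recursive_in_exponent:
  assumes "recursive_in A c" "recursive_in A n"
  shows "recursive_in A (\<lambda>m. exponent (c m) (n m))"
  unfolding exponent_def by (intro recursive_in_add recursive_in_basic assms)

lemma recursive_in_offset:
  assumes "recursive_in A c" "recursive_in A n"
  shows "recursive_in A (\<lambda>m. offset (c m) (n m))"
  unfolding offset_def
  by (intro recursive_in_sum recursive_in_mult recursive_in_basic recursive_in_exponent
    recursive_in_comp[OF assms(1)] assms(2))

lemma decidable_in_accepts: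
  assumes "recursive_in A c" "recursive_in A e" "recursive_in A D"
  shows "decidable_in A (\<lambda>m. accepts (c m) (e m) (list_decode (D m)))"
proof -
  note fA = recursive_in_mono[OF f] and RA = decidable_in_mono[OF R]
  note comps = recursive_in_comp[OF assms(1)] recursive_in_comp[OF assms(2)] recursive_in_comp[OF assms(3)]
  show ?thesis unfolding accepts_def arity_def
    by (intro decidable_in_conj decidable_in_all_less decidable_in_tree_copy fA decidable_in_reservoir RA
      recursive_in_nth_code recursive_in_power recursive_in_exponent recursive_in_length_list_decode
      recursive_in_basic comps assms)
qed

text \<open>The set \<open>X\<close> may vary with the context: it is the oracle itself when the
  homogeneous set is computed, but a decoded finite string in the randomness test.\<close>

lemma recursive_in_walk:
  assumes X: "decidable_in A (\<lambda>m. psnd m \<in> X (pfst m))" and c: "recursive_in A c"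
    and t: "recursive_in A t"
  shows "recursive_in A (\<lambda>m. list_encode (walk (X m) (c m) (t m)))"
proof -
  define step where "step m i r = (if accepts (c m) (pfst i) (list_decode r)
    then Suc (prod_encode (nth_code (pfst i) (choice (X m) (c m) (length (list_decode r))), r)) else r)" for m i r
  have eq: "list_encode (walk (X m) (c m) i) = rec_nat 0 (step m) i" for m i
  proof (induction i)
    case (Suc i)
    show ?case by (simp add: Suc[symmetric] Let_def) (simp add: step_def)
  qed simp
  show ?thesis unfolding eq
    by (rule recursive_in_rec_nat[OF recursive_in_const t], unfold step_def choice_def)
       (intro recursive_in_basic recursive_in_if decidable_in_accepts recursive_in_nth_code recursive_in_set_encode
       decidable_in_comp2[OF X] recursive_in_add recursive_in_offset recursive_in_mult recursive_in_exponent
       recursive_in_length_list_decode recursive_in_comp[OF c] t)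
qed

end

context random_walk
begin

section \<open>Use of the oracle by the walk\<close>

lemma length_walk_mono: "t \<le> t' \<Longrightarrow> length (walk X c t) \<le> length (walk X c t')"
  by (rule lift_Suc_mono_le[where f = "\<lambda>t. length (walk X c t)"]) (auto simp: Let_def)

lemma offset_mono: "n \<le> n' \<Longrightarrow> offset c n \<le> offset c n'"
  unfolding offset_def by (intro sum_mono2) auto

lemma offset_Suc: "offset c (Suc n) = offset c n + exponent c n * d"
  by (simp add: offset_def)

lemma choice_cong:
  assumes "\<And>i. i < offset c (Suc n) \<Longrightarrow> i \<in> X \<longleftrightarrow> i \<in> Y"
  shows "choice X c n = choice Y c n"
proof -
  have "{j. j < exponent c n * d \<and> offset c n + j \<in> X} = {j. j < exponent c n * d \<and> offset c n + j \<in> Y}"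
    using assms by (auto simp: offset_Suc)
  then show ?thesis by (simp add: choice_def)
qed

text \<open>A stage with \<open>n\<close> points has read only the bits below
  \<open>offset c n\<close>, and earlier stages have no more points.\<close>

lemma walk_cong:
  assumes "\<And>i. i < offset c (length (walk X c t)) \<Longrightarrow> i \<in> X \<longleftrightarrow> i \<in> Y"
  shows "walk X c t = walk Y c t"
  using assms
proof (induction t)
  case (Suc t)
  have "offset c (length (walk X c t)) \<le> offset c (length (walk X c (Suc t)))"
    by (intro offset_mono length_walk_mono) simp
  then have eq: "walk X c t = walk Y c t" using Suc.prems by (intro Suc.IH) auto
  show ?case
  proof (cases "accepts c (pfst t) (walk X c t)")
    case True
    then have "choice X c (length (walk X c t)) = choice Y c (length (walk X c t))"
      using Suc.prems by (intro choice_cong) (simp add: Let_def)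
    then show ?thesis using eq by (simp add: Let_def)
  qed (use eq in \<open>simp add: Let_def\<close>)
qed simp

text \<open>A tree has exactly as many leaves as the bits drawn have values, so
  \<open>choice\<close> picks a leaf uniformly.\<close>

lemma arity_power: "arity c n ^ d = 2 ^ (exponent c n * d)"
  by (simp add: arity_def power_mult)

lemma choice_less: "choice X c n < arity c n ^ d"
  unfolding choice_def arity_power by (rule set_encode_less) auto

lemma walk_Suc_in_reservoir:
  assumes "accepts c (pfst t) (walk X c t)"
  shows "nth_code (pfst t) (choice X c (length (walk X c t))) \<in> reservoir f a R (walk X c t)"
  using assms choice_less unfolding accepts_def by blast

lemma sorted_walk: "sorted_wrt (\<lambda>y x. x < y \<and> f x y = a) (walk X c t)"
proof (induction t)
  case (Suc t)
  then show ?case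
    using walk_Suc_in_reservoir[of c t X] by (auto simp: Let_def reservoir_def)
qed simp

lemma walk_append: "\<exists>xs. walk X c (t + i) = xs @ walk X c t"
proof (induction i)
  case (Suc i)
  then obtain xs where "walk X c (t + i) = xs @ walk X c t" by blast
  then have "walk X c (t + Suc i) = xs @ walk X c t \<or> (\<exists>x. walk X c (t + Suc i) = (x # xs) @ walk X c t)"
    by (simp add: Let_def)
  then show ?case by blast
qed simp

lemma walk_appendE:
  assumes "t \<le> t'" obtains xs where "walk X c t' = xs @ walk X c t"
  using walk_append[of X c t "t' - t"] assms by auto

section \<open>The randomness test\<close>

definition trapped :: "nat \<Rightarrow> nat set set" where
  "trapped c = {X. \<exists>t. finite (reservoir f a R (walk X c t))}"

text \<open>Being trapped is witnessed by a stage \<open>t\<close>, a long enough prefix of the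
  oracle and a bound \<open>m\<close> on the reservoir. That nothing in a computable set lies above
  \<open>m\<close> is decidable in \<open>zero_jump\<close>.\<close>

lemma uniformly_sigma01_trapped: "uniformly_sigma01 zero_jump trapped"
proof -
  \<comment> \<open>A word \<open>w\<close> pairs the index \<open>c\<close> with a coded string;
    positions beyond the string count as 0.\<close>
  define B where "B w = {i. i < length (list_decode (psnd w)) \<and> nth_code (psnd w) i = 1}" for w
  \<comment> \<open>The offset condition ensures that stage \<open>t\<close> reads no bit beyond the
    string, so every extension has the same stage.\<close>
  define P where "P w t m \<longleftrightarrow> offset (pfst w) (length (walk (B w) (pfst w) t)) \<le> length (list_decode (psnd w)) \<and>
    \<not> (\<exists>y. m \<le> y \<and> y \<in> reservoir f a R (walk (B w) (pfst w) t))" for w t m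
  have decB: "decidable_in A (\<lambda>m. psnd m \<in> B (pfst m))" for A
    unfolding B_def mem_Collect_eq
    by (intro decidable_in_conj decidable_in_less decidable_in_eq recursive_in_nth_code
      recursive_in_length_list_decode recursive_in_basic)
  let ?walk = "\<lambda>m. list_encode (walk (B (pfst m)) (pfst (pfst m)) (pfst (psnd m)))"
  have rec_walk: "recursive_in A ?walk" for A
    by (rule recursive_in_walk) (intro recursive_in_basic decidable_in_comp2[OF decB])+
  have "decidable_in {} (\<lambda>m. psnd (pfst m) \<le> psnd m \<and> psnd m \<in> reservoir f a R (list_decode (pfst (pfst m))))"
    by (intro decidable_in_conj decidable_in_le recursive_in_basic decidable_in_reservoir f R)
  from decidable_in_zero_jump_ex[where P = "\<lambda>u y. psnd u \<le> y \<and> y \<in> reservoir f a R (list_decode (pfst u))", OF this]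
  have ex: "decidable_in zero_jump (\<lambda>u. \<exists>y. psnd u \<le> y \<and> y \<in> reservoir f a R (list_decode (pfst u)))" .
  have "decidable_in zero_jump (\<lambda>m. offset (pfst (pfst m)) (length (list_decode (?walk m))) \<le> length (list_decode (psnd (pfst m))) \<and>
    \<not> (\<exists>y. psnd (prod_encode (?walk m, psnd (psnd m))) \<le> y \<and>
        y \<in> reservoir f a R (list_decode (pfst (prod_encode (?walk m, psnd (psnd m)))))))"
    by (intro decidable_in_conj decidable_in_le recursive_in_offset recursive_in_length_list_decode
      recursive_in_basic rec_walk decidable_in_not decidable_in_comp[OF ex])
  then have "decidable_in zero_jump (\<lambda>m. P (pfst m) (pfst (psnd m)) (psnd (psnd m)))"
    by (simp add: P_def)
  then have "ce_in zero_jump {w. \<exists>k. P w (pfst k) (psnd k)}" by (rule ce_in_ex)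
  moreover have "trapped c = {X. \<exists>k. prod_encode (c, list_encode (init_seg X k)) \<in> {w. \<exists>k. P w (pfst k) (psnd k)}}" for c
  proof -
    have B: "B (prod_encode (c, list_encode (init_seg X k))) = X \<inter> {..<k}" for X k
      by (auto simp: B_def init_seg_def nth_code_list_encode split: if_splits)
    have P: "P (prod_encode (c, list_encode (init_seg X k))) t m \<longleftrightarrow>
        offset c (length (walk (X \<inter> {..<k}) c t)) \<le> k \<and>
        reservoir f a R (walk (X \<inter> {..<k}) c t) \<subseteq> {..<m}" for X k t m
      unfolding P_def B by (auto simp: init_seg_def not_le)
    have "X \<in> trapped c \<longleftrightarrow> (\<exists>k t m. P (prod_encode (c, list_encode (init_seg X k))) t m)" for X
    proof
      assume "X \<in> trapped c"
      then obtain t where t: "finite (reservoir f a R (walk X c t))" by (auto simp: trapped_def)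
      then obtain m where m: "reservoir f a R (walk X c t) \<subseteq> {..<m}" using finite_nat_iff_bounded by blast
      have "walk X c t = walk (X \<inter> {..<offset c (length (walk X c t))}) c t"
        by (rule walk_cong) simp
      then show "\<exists>k t m. P (prod_encode (c, list_encode (init_seg X k))) t m"
        unfolding P using m by (metis order_refl)
    next
      assume "\<exists>k t m. P (prod_encode (c, list_encode (init_seg X k))) t m"
      then obtain k t m where k: "offset c (length (walk (X \<inter> {..<k}) c t)) \<le> k"
        "reservoir f a R (walk (X \<inter> {..<k}) c t) \<subseteq> {..<m}" unfolding P by blast
      have "walk (X \<inter> {..<k}) c t = walk X c t" using k(1) by (intro walk_cong) auto
      then show "X \<in> trapped c" using k(2) finite_subset[OF _ finite_lessThan] by (auto simp: trapped_def)
    qed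
    moreover have "(\<exists>k. prod_encode (c, list_encode (init_seg X k)) \<in> {w. \<exists>k. P w (pfst k) (psnd k)}) \<longleftrightarrow>
        (\<exists>k t m. P (prod_encode (c, list_encode (init_seg X k))) t m)" for X
      by (auto, metis fst_conv prod_encode_inverse snd_conv)
    ultimately show ?thesis by blast
  qed
  ultimately show ?thesis unfolding uniformly_sigma01_def by blast
qed

end

section \<open>Measure of the test and the computed homogeneous set\<close>

definition computable_infinite :: "nat set \<Rightarrow> bool" where
  "computable_infinite R \<longleftrightarrow> infinite R \<and> decidable_in {} (\<lambda>y. y \<in> R)"

text \<open>\<open>tree_copies\<close> keeps an untrapped walk moving; \<open>no_dead_tree\<close>
  and \<open>q\<close> bound the probability of drawing a dead end.\<close>

locale sparse_walk = random_walk +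
  fixes k :: nat
  assumes infinite_R: "infinite R"
    and tree_copies: "\<And>R' N. computable_infinite R' \<Longrightarrow> \<exists>g. tree_copy f N d a g \<and> g ` {..<N ^ d} \<subseteq> R'"
    and no_dead_tree: "\<And>D h. infinite (reservoir f a R D) \<Longrightarrow> tree_copy f k d a h \<Longrightarrow>
      (\<And>i. i < k ^ d \<Longrightarrow> h i \<in> reservoir f a R D \<and> finite (reservoir f a R (h i # D))) \<Longrightarrow> False"
    and q: "d * k \<le> 2 ^ q"
begin

lemma card_dead_ends:
  assumes "infinite (reservoir f a R D)" "accepts c e D"
  shows "card {v. v < arity c (length D) ^ d \<and> finite (reservoir f a R (nth_code e v # D))} *
    2 ^ (length D + c + 1) \<le> arity c (length D) ^ d"
proof -
  let ?N = "arity c (length D)"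
  let ?B = "{v. v < ?N ^ d \<and> finite (reservoir f a R (nth_code e v # D))}"
  have "?N * card ?B \<le> d * k * ?N ^ d"
  proof (rule tree_copy_density)
    show "tree_copy f ?N d a (nth_code e)" using assms(2) by (simp add: accepts_def)
    show "\<not> (\<exists>h. tree_copy f k d a h \<and> h ` {..<k ^ d} \<subseteq> nth_code e ` ?B)"
    proof
      assume "\<exists>h. tree_copy f k d a h \<and> h ` {..<k ^ d} \<subseteq> nth_code e ` ?B"
      then obtain h where h: "tree_copy f k d a h" "h ` {..<k ^ d} \<subseteq> nth_code e ` ?B" by blast
      show False
      proof (rule no_dead_tree[OF assms(1) h(1)])
        fix i assume "i < k ^ d"
        then have "h i \<in> nth_code e ` ?B" using h(2) by blast
        then show "h i \<in> reservoir f a R D \<and> finite (reservoir f a R (h i # D))"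
          using assms(2) by (auto simp: accepts_def)
      qed
    qed
  qed auto
  also have "\<dots> \<le> 2 ^ q * ?N ^ d" using q by (rule mult_le_mono1)
  finally have "?N * card ?B \<le> 2 ^ q * ?N ^ d" .
  \<comment> \<open>The factor \<open>2 ^ q\<close> of the arity absorbs \<open>d * k\<close>; the
    rest is the error bound.\<close>
  moreover have "?N * m = 2 ^ q * (m * 2 ^ (length D + c + 1))" for m
    by (simp add: arity_def exponent_def power_add)
  ultimately have "2 ^ q * (card ?B * 2 ^ (length D + c + 1)) \<le> 2 ^ q * ?N ^ d" by metis
  then show ?thesis by (simp only: mult_le_cancel1) simp
qed

text \<open>A trapped walk draws a dead end as its point number \<open>n\<close> for some
  \<open>n\<close>. These events have measure at most \<open>(1 / 2) ^ (n + c + 1)\<close>, which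
  sums to \<open>(1 / 2) ^ c\<close>.\<close>

lemma class_measure_trapped: "class_measure (trapped c) \<le> (1 / 2) ^ c"
proof -
  define Q where "Q n S v \<longleftrightarrow> (\<exists>t. length (walk S c t) = n \<and> accepts c (pfst t) (walk S c t) \<and>
    infinite (reservoir f a R (walk S c t)) \<and>
    finite (reservoir f a R (nth_code (pfst t) v # walk S c t)))" for n S v
  define E where "E n = {x. Q n (Collect x \<inter> {..<offset c n})
    (set_encode {j. j < exponent c n * d \<and> x (offset c n + j)})}" for n
  \<comment> \<open>For a fixed past, at most one stage draws point number \<open>n\<close>, because
    accepting lengthens the list. Only the dead ends of one tree count.\<close>
  have card_Q: "card {v. v < 2 ^ (exponent c n * d) \<and> Q n S v} \<le>
      2 ^ (exponent c n * d) div 2 ^ (n + c + 1)" for n S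
  proof (cases "\<exists>t. length (walk S c t) = n \<and> accepts c (pfst t) (walk S c t) \<and>
    infinite (reservoir f a R (walk S c t))")
    case True
    then obtain t where t: "length (walk S c t) = n" "accepts c (pfst t) (walk S c t)"
      "infinite (reservoir f a R (walk S c t))" by blast
    have unique: "t' = t" if "length (walk S c t') = n" "accepts c (pfst t') (walk S c t')" for t'
    proof (rule ccontr)
      have Suc_t: "length (walk S c (Suc t)) = Suc n" "length (walk S c (Suc t')) = Suc n"
        using t that by (simp_all add: Let_def)
      assume "t' \<noteq> t"
      then consider "Suc t \<le> t'" | "Suc t' \<le> t" by linarith
      then show False
        using length_walk_mono[of "Suc t" t' S c] length_walk_mono[of "Suc t'" t S c] Suc_t t(1) that(1)
        by cases auto
    qed
    have "{v. v < 2 ^ (exponent c n * d) \<and> Q n S v} =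
        {v. v < arity c n ^ d \<and> finite (reservoir f a R (nth_code (pfst t) v # walk S c t))}"
      unfolding Q_def arity_power using t unique by blast
    then have "card {v. v < 2 ^ (exponent c n * d) \<and> Q n S v} * 2 ^ (n + c + 1) \<le> 2 ^ (exponent c n * d)"
      using card_dead_ends[OF t(3,2)] t(1) by (simp add: arity_power)
    then show ?thesis by (simp add: less_eq_div_iff_mult_less_eq)
  next
    case False
    then have "{v. v < 2 ^ (exponent c n * d) \<and> Q n S v} = {}" by (auto simp: Q_def)
    then show ?thesis by (simp only: card.empty le0)
  qed
  have sets_E: "E n \<in> sets coin_measure" for n
    unfolding E_def using card_Q by (rule coin_measure_fresh_bits)
  have measure_E: "measure coin_measure (E n) \<le> (1 / 2) ^ (n + c + 1)" for n
  proof -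
    have "measure coin_measure (E n) \<le> real (2 ^ (exponent c n * d) div 2 ^ (n + c + 1)) / 2 ^ (exponent c n * d)"
      unfolding E_def using card_Q by (rule coin_measure_fresh_bits)
    also have "\<dots> \<le> (2 ^ (exponent c n * d) / 2 ^ (n + c + 1)) / 2 ^ (exponent c n * d)"
      using of_nat_div_le_of_nat[where 'a = real, of "2 ^ (exponent c n * d)" "2 ^ (n + c + 1)"]
      by (intro divide_right_mono) simp_all
    also have "\<dots> = (1 / 2) ^ (n + c + 1)" by (simp add: power_one_over divide_simps)
    finally show ?thesis .
  qed
  have sums: "(\<lambda>n. (1 / 2) ^ (n + c + 1) :: real) sums ((1 / 2) ^ c)"
    using sums_mult[OF power_half_series, of "(1 / 2) ^ c"] by (simp add: power_add mult_ac)
  have summable: "summable (\<lambda>n. measure coin_measure (E n))"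
    using measure_E by (intro summable_comparison_test'[OF sums_summable[OF sums], of 0]) simp
  have "{x. Collect x \<in> trapped c} \<subseteq> (\<Union>n. E n)"
  proof
    fix x assume "x \<in> {x. Collect x \<in> trapped c}"
    then obtain t where "finite (reservoir f a R (walk (Collect x) c t))" by (auto simp: trapped_def)
    \<comment> \<open>At the first stage with a finite reservoir, a dead end has just been drawn. It
      is not stage 0, where the reservoir is \<open>R\<close>.\<close>
    then obtain t where t: "finite (reservoir f a R (walk (Collect x) c t))"
      "\<And>s. s < t \<Longrightarrow> infinite (reservoir f a R (walk (Collect x) c s))"
      using exists_least_iff[of "\<lambda>t. finite (reservoir f a R (walk (Collect x) c t))"] by blast
    have "t \<noteq> 0"
    proof
      assume "t = 0"
      then show False using t(1) infinite_R by (simp add: reservoir_def)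
    qed
    then obtain s where s: "t = Suc s" by (cases t) auto
    let ?D = "walk (Collect x) c s"
    have inf: "infinite (reservoir f a R ?D)" using t(2) s by simp
    then have acc: "accepts c (pfst s) ?D" using t(1) unfolding s by (simp add: Let_def split: if_splits)
    have "walk (Collect x) c s = walk (Collect x \<inter> {..<offset c (length ?D)}) c s"
      by (rule walk_cong) simp
    moreover have "finite (reservoir f a R (nth_code (pfst s) (choice (Collect x) c (length ?D)) # ?D))"
      using t(1) acc unfolding s by (simp add: Let_def)
    ultimately have "Q (length ?D) (Collect x \<inter> {..<offset c (length ?D)}) (choice (Collect x) c (length ?D))"
      unfolding Q_def using acc inf by (intro exI[of _ s]) simp
    then have "x \<in> E (length ?D)" by (simp add: E_def choice_def)
    then show "x \<in> (\<Union>n. E n)" by blast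
  qed
  then have "class_measure (trapped c) \<le> measure coin_measure (\<Union>n. E n)"
    unfolding class_measure_def using sets_E by (intro coin.finite_measure_mono) auto
  also have "\<dots> \<le> (\<Sum>n. measure coin_measure (E n))"
    using sets_E summable by (intro coin.finite_measure_subadditive_countably) auto
  also have "\<dots> \<le> (1 / 2) ^ c"
    using suminf_le[OF measure_E summable sums_summable[OF sums]] sums_unique[OF sums] by simp
  finally show ?thesis .
qed

text \<open>An untrapped walk always has a computable infinite reservoir, which contains a tree of
  the required arity.\<close>

lemma walk_unbounded:
  assumes "X \<notin> trapped c" shows "\<exists>t. n \<le> length (walk X c t)"
proof (induction n)
  case (Suc n)
  then obtain t where t: "n \<le> length (walk X c t)" by blast
  let ?D = "walk X c t"
  have "decidable_in {} (\<lambda>y. y \<in> reservoir f a R (list_decode (list_encode ?D)))"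
    by (intro decidable_in_reservoir f R recursive_in_basic)
  then have "computable_infinite (reservoir f a R ?D)"
    using assms by (simp add: computable_infinite_def trapped_def)
  from tree_copies[OF this] obtain g where g: "tree_copy f (arity c (length ?D)) d a g"
    "g ` {..<arity c (length ?D) ^ d} \<subseteq> reservoir f a R ?D" by blast
  let ?e = "list_encode (map g [0..<arity c (length ?D) ^ d])"
  have e: "nth_code ?e i = g i" if "i < arity c (length ?D) ^ d" for i
    using that by (simp add: nth_code_list_encode)
  have acc: "accepts c ?e ?D"
    unfolding accepts_def using g e tree_copy_cong[of "arity c (length ?D)" d "nth_code ?e" g f a] by auto
  \<comment> \<open>A time not before \<open>t\<close> at which the candidate is \<open>?e\<close>:
    either the walk has grown by then, or it accepts \<open>?e\<close>.\<close>
  let ?t = "prod_encode (?e, t)"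
  obtain xs where xs: "walk X c ?t = xs @ ?D" using walk_appendE[OF le_prod_encode_2] by blast
  show ?case
  proof (cases "xs = []")
    case True
    then have "length (walk X c (Suc ?t)) = Suc (length ?D)" using acc xs by (simp add: Let_def)
    then show ?thesis using t by (metis Suc_le_mono)
  next
    case False
    then have "Suc n \<le> length (walk X c ?t)" using t xs by (cases xs) auto
    then show ?thesis by blast
  qed
qed simp

text \<open>The points are drawn in increasing order, so membership of \<open>x\<close> is settled
  once a point above \<open>x\<close> has appeared.\<close>

lemma computes_homogeneous:
  assumes "X \<notin> trapped c"
  shows "\<exists>H. infinite H \<and> (\<forall>x\<in>H. \<forall>y\<in>H. x < y \<longrightarrow> f x y = a) \<and> computes X H"
proof (intro exI conjI)
  let ?H = "\<Union>t. set (walk X c t)"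
  have subset: "set (walk X c t) \<subseteq> set (walk X c t')" if "t \<le> t'" for t t'
    using walk_appendE[OF that] by (metis Un_upper2 set_append)
  show inf: "infinite ?H"
  proof
    assume fin: "finite ?H"
    obtain t where "Suc (card ?H) \<le> length (walk X c t)" using walk_unbounded[OF assms] by blast
    moreover have "distinct (walk X c t)"
      using sorted_wrt_nth_less[OF sorted_walk[of X c t]] unfolding distinct_conv_nth
      by (metis less_irrefl linorder_neqE_nat)
    ultimately have "Suc (card ?H) \<le> card (set (walk X c t))" by (simp add: distinct_card)
    also have "\<dots> \<le> card ?H" using fin by (intro card_mono) auto
    finally show False by simp
  qed
  show "\<forall>x\<in>?H. \<forall>y\<in>?H. x < y \<longrightarrow> f x y = a"
  proof (intro ballI impI)
    fix x y assume "x \<in> ?H" "y \<in> ?H" "x < y"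
    then obtain t1 t2 where "x \<in> set (walk X c t1)" "y \<in> set (walk X c t2)" by blast
    then obtain t where "x \<in> set (walk X c t)" "y \<in> set (walk X c t)"
      using subset[of t1 "max t1 t2"] subset[of t2 "max t1 t2"] that[of "max t1 t2"] by auto
    then obtain i j where ij: "i < length (walk X c t)" "j < length (walk X c t)"
      "x = walk X c t ! i" "y = walk X c t ! j" by (metis in_set_conv_nth)
    have pair: "walk X c t ! v < walk X c t ! u \<and> f (walk X c t ! v) (walk X c t ! u) = a"
      if "u < v" "v < length (walk X c t)" for u v
      using sorted_wrt_nth_less[OF sorted_walk that] .
    consider "i < j" | "i = j" | "j < i" by linarith
    then show "f x y = a"
      using pair[of i j] pair[of j i] ij \<open>x < y\<close> by cases auto
  qed
  define T where "T x = (LEAST t. \<exists>z\<in>set (walk X c t). x < z)" for x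
  have ex: "\<exists>t. \<exists>z\<in>set (walk X c t). x < z" for x
  proof -
    obtain z where "z \<in> ?H" "x < z" using inf by (meson infinite_nat_iff_unbounded)
    then show ?thesis by blast
  qed
  have mem: "x \<in> ?H \<longleftrightarrow> x \<in> set (walk X c (T x))" for x
  proof
    assume "x \<in> ?H"
    then obtain t where t: "x \<in> set (walk X c t)" by blast
    show "x \<in> set (walk X c (T x))"
    proof (cases "t \<le> T x")
      case True then show ?thesis using subset t by blast
    next
      case False
      then obtain xs where xs: "walk X c t = xs @ walk X c (T x)" using walk_appendE[of "T x" t] by auto
      obtain z where z: "z \<in> set (walk X c (T x))" "x < z" using LeastI_ex[OF ex[of x]] by (auto simp: T_def)
      \<comment> \<open>Points drawn after \<open>z\<close> exceed \<open>z\<close>, hence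
        \<open>x\<close>.\<close>
      have "x \<notin> set xs" using sorted_walk[of X c t] z unfolding xs sorted_wrt_append by fastforce
      then show ?thesis using t xs by simp
    qed
  qed blast
  have decX: "decidable_in X (\<lambda>m. psnd m \<in> X)"
    by (intro decidable_in_oracle recursive_in_basic)
  have rec_walk: "recursive_in X h \<Longrightarrow> recursive_in X (\<lambda>m. list_encode (walk X c (h m)))" for h
    by (rule recursive_in_walk[OF decX recursive_in_const])
  have "decidable_in X (\<lambda>m. \<not> (\<forall>z\<in>set (list_decode (list_encode (walk X c (psnd m)))). \<not> pfst m < z))"
    by (intro decidable_in_not decidable_in_Ball_list_decode decidable_in_less rec_walk recursive_in_basic)
  then have "decidable_in X (\<lambda>m. \<exists>z\<in>set (walk X c (psnd m)). pfst m < z)" by simp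
  then have "recursive_in X T" unfolding T_def using ex by (rule recursive_in_Least)
  then have "decidable_in X (\<lambda>x. \<not> (\<forall>z\<in>set (list_decode (list_encode (walk X c (T x)))). \<not> x = z))"
    by (intro decidable_in_not decidable_in_Ball_list_decode decidable_in_eq rec_walk recursive_in_basic)
  then have "decidable_in X (\<lambda>x. x \<in> ?H)" by (simp only: mem) simp
  then show "computes X ?H" unfolding decidable_in_def recursive_in_def computes_def .
qed

lemma two_random_computes_homogeneous:
  assumes "two_random X"
  shows "\<exists>H. infinite H \<and> (\<forall>x\<in>H. \<forall>y\<in>H. x < y \<longrightarrow> f x y = a) \<and> computes X H"
proof -
  have "X \<notin> (\<Inter>c. trapped c)"
    using assms uniformly_sigma01_trapped class_measure_trapped
    unfolding two_random_def martin_lof_random_rel_def by blast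
  then show ?thesis using computes_homogeneous by blast
qed

end

section \<open>Minimal omitted structure and conclusion\<close>

lemma minimal_avoided_structure:
  assumes "\<And>g. \<not> tree_copy f 2 d0 0 g"
  obtains d k c j R where "c \<in> {0, 1}" "computable_infinite R"
    "\<And>R' N c'. computable_infinite R' \<Longrightarrow> c' \<in> {0, 1} \<Longrightarrow> \<exists>g. tree_copy f N d c' g \<and> g ` {..<N ^ d} \<subseteq> R'"
    "\<And>R'. computable_infinite R' \<Longrightarrow>
       \<exists>g. blocks f j (k ^ d) (tree_copy f k d (1 - c)) c g \<and> g ` {..<j * k ^ d} \<subseteq> R'"
    "\<And>g. blocks f (Suc j) (k ^ d) (tree_copy f k d (1 - c)) c g \<Longrightarrow> \<not> g ` {..<Suc j * k ^ d} \<subseteq> R"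
proof -
  define Q where "Q d \<longleftrightarrow> (\<exists>R k c. computable_infinite R \<and> c \<in> {0, 1} \<and>
    (\<forall>g. tree_copy f k d c g \<longrightarrow> \<not> g ` {..<k ^ d} \<subseteq> R))" for d
  have "computable_infinite UNIV" by (simp add: computable_infinite_def decidable_in_const)
  then have "Q d0" using assms unfolding Q_def by blast
  then obtain d1 where d1: "Q d1" "\<And>d. d < d1 \<Longrightarrow> \<not> Q d" by (metis exists_least_iff)
  \<comment> \<open>A tree of depth 0 is a single point, which no infinite set omits; so the minimal
    depth is a successor.\<close>
  have "\<not> Q 0"
  proof
    assume "Q 0"
    then obtain R :: "nat set" where R: "infinite R" "\<And>g :: nat \<Rightarrow> nat. \<not> g ` {..<Suc 0} \<subseteq> R"
      unfolding Q_def computable_infinite_def by auto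
    then obtain r where "r \<in> R" by (metis finite.emptyI ex_in_conv)
    then show False using R(2)[of "\<lambda>_. r"] by auto
  qed
  then obtain d where d: "d1 = Suc d" using d1(1) by (cases d1) auto
  obtain R0 k c where R0: "computable_infinite R0" "c \<in> {0, 1}"
    "\<And>g. tree_copy f k (Suc d) c g \<Longrightarrow> \<not> g ` {..<k ^ Suc d} \<subseteq> R0"
    using d1(1) unfolding Q_def d by blast
  define P where "P j \<longleftrightarrow> (\<exists>R. computable_infinite R \<and>
    (\<forall>g. blocks f j (k ^ d) (tree_copy f k d (1 - c)) c g \<longrightarrow> \<not> g ` {..<j * k ^ d} \<subseteq> R))" for j
  \<comment> \<open>A row of \<open>k\<close> blocks is the whole omitted tree of depth
    \<open>Suc d\<close>.\<close>
  have "P k" using R0(1,3) unfolding P_def by auto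
  then obtain j1 where j1: "P j1" "\<And>j. j < j1 \<Longrightarrow> \<not> P j" by (metis exists_least_iff)
  \<comment> \<open>An empty row lies in every set, so the minimal length is a successor.\<close>
  have "\<not> P 0" by (auto simp: P_def blocks_def)
  then obtain j where j: "j1 = Suc j" using j1(1) by (cases j1) auto
  obtain R where R: "computable_infinite R"
    "\<And>g. blocks f (Suc j) (k ^ d) (tree_copy f k d (1 - c)) c g \<Longrightarrow> \<not> g ` {..<Suc j * k ^ d} \<subseteq> R"
    using j1(1) unfolding P_def j by blast
  show thesis
  proof (rule that[OF R0(2) R(1)])
    show "\<exists>g. tree_copy f N d c' g \<and> g ` {..<N ^ d} \<subseteq> R'"
      if "computable_infinite R'" "c' \<in> {0, 1}" for R' N c'
      using d1(2)[of d] that unfolding d Q_def by blast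
    show "\<exists>g. blocks f j (k ^ d) (tree_copy f k d (1 - c)) c g \<and> g ` {..<j * k ^ d} \<subseteq> R'"
      if "computable_infinite R'" for R'
      using j1(2)[of j] that unfolding j P_def by blast
  qed (rule R(2))
qed

lemma reservoir_Cons:
  "reservoir f a R (x # D) = {y \<in> reservoir f a R D. x < y \<and> f x y = a}"
  by (auto simp: reservoir_def)

lemma blocks_Cons:
  assumes "P h" "blocks f j M P c g"
    and "\<And>x y. x < M \<Longrightarrow> y < j * M \<Longrightarrow> h x < g y \<and> f (h x) (g y) = c"
    and cong: "\<And>u v. (\<And>i. i < M \<Longrightarrow> u i = v i) \<Longrightarrow> P u \<longleftrightarrow> P v"
  shows "blocks f (Suc j) M P c (\<lambda>x. if x < M then h x else g (x - M))"
    (is "blocks f _ M P c ?g")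
proof -
  have first: "?g (0 * M + x) = h x" if "x < M" for x using that by simp
  have later: "?g (Suc i * M + x) = g (i * M + x)" for i x by simp
  have "P (\<lambda>x. ?g (i * M + x))" if "i < Suc j" for i
  proof (cases i)
    case 0
    then show ?thesis using assms(1) by (subst cong[of _ h]) auto
  next
    case (Suc i')
    then show ?thesis using assms(2) that unfolding Suc later by (simp add: blocks_def)
  qed
  moreover have "?g (i * M + x) < ?g (i' * M + y) \<and> f (?g (i * M + x)) (?g (i' * M + y)) = c"
    if i: "i < i'" "i' < Suc j" and xy: "x < M" "y < M" for i i' x y
  proof -
    obtain i2 where i2: "i' = Suc i2" using i(1) by (cases i') auto
    show ?thesis
    proof (cases i)
      case 0
      show ?thesis unfolding i2 later 0 first[OF xy(1)]
        using assms(3)[OF xy(1) block_index_less[OF _ xy(2)]] i i2 by simp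
    next
      case (Suc i1)
      show ?thesis unfolding i2 later Suc
        using assms(2) i xy unfolding i2 Suc blocks_def by simp
    qed
  qed
  ultimately show ?thesis unfolding blocks_def by blast
qed

text \<open>If every point of a copy of a tree were a dead end of the reservoir, then almost all points of
  the reservoir would be joined to the whole copy in the other color, and one more block would fit.\<close>

lemma dead_ends_contain_no_tree_copy:
  assumes f: "recursive_in {} (\<lambda>m. f (pfst m) (psnd m))" "\<And>x y. x < y \<Longrightarrow> f x y \<in> {0, 1}"
    and c: "c \<in> {0, 1}" and R: "computable_infinite R"
    and j: "\<And>R'. computable_infinite R' \<Longrightarrow>
      \<exists>g. blocks f j (k ^ d) (tree_copy f k d (1 - c)) c g \<and> g ` {..<j * k ^ d} \<subseteq> R'"
    and Suc_j: "\<And>g. blocks f (Suc j) (k ^ d) (tree_copy f k d (1 - c)) c g \<Longrightarrow> \<not> g ` {..<Suc j * k ^ d} \<subseteq> R"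
    and inf: "infinite (reservoir f (1 - c) R D)" and h: "tree_copy f k d (1 - c) h"
    and dead: "\<And>i. i < k ^ d \<Longrightarrow> h i \<in> reservoir f (1 - c) R D \<and> finite (reservoir f (1 - c) R (h i # D))"
  shows False
proof -
  let ?S = "reservoir f (1 - c) R D" and ?M = "k ^ d"
  \<comment> \<open>The reservoir points joined to the whole copy in color \<open>c\<close>; a row
    of \<open>j\<close> blocks found here can follow \<open>h\<close>.\<close>
  define R' where "R' = {y \<in> ?S. y \<in> reservoir f c UNIV (map h [0..<?M])}"
  have decR: "decidable_in {} (\<lambda>y. y \<in> R)" using R by (simp add: computable_infinite_def)
  have decU: "decidable_in {} (\<lambda>y. y \<in> UNIV)" using decidable_in_const[of "{}" True] by simp
  have "decidable_in {} (\<lambda>y. y \<in> reservoir f (1 - c) R (list_decode (list_encode D)) \<and>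
      y \<in> reservoir f c UNIV (list_decode (list_encode (map h [0..<?M]))))"
    by (intro decidable_in_conj decidable_in_reservoir[OF f(1) decR] decidable_in_reservoir[OF f(1) decU] recursive_in_basic)
  then have "decidable_in {} (\<lambda>y. y \<in> R')" by (simp add: R'_def)
  moreover have "infinite R'"
  proof
    assume fin: "finite R'"
    \<comment> \<open>A reservoir point outside \<open>R'\<close> is at most some \<open>h i\<close>
      or joined to it in color \<open>1 - c\<close>. The dead ends leave only finitely many of
      these.\<close>
    have "?S \<subseteq> R' \<union> (\<Union>i<?M. {..h i} \<union> reservoir f (1 - c) R (h i # D))"
    proof
      fix y assume y: "y \<in> ?S"
      show "y \<in> R' \<union> (\<Union>i<?M. {..h i} \<union> reservoir f (1 - c) R (h i # D))"
      proof (rule ccontr)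
        assume n: "y \<notin> R' \<union> (\<Union>i<?M. {..h i} \<union> reservoir f (1 - c) R (h i # D))"
        have "h i < y \<and> f (h i) y = c" if "i < ?M" for i
        proof -
          have "\<not> y \<le> h i" "y \<notin> reservoir f (1 - c) R (h i # D)" using n that by auto
          then show ?thesis using f(2)[of "h i" y] c y by (auto simp: reservoir_Cons not_le)
        qed
        then have "y \<in> R'" using y by (auto simp: R'_def reservoir_def)
        then show False using n by blast
      qed
    qed
    moreover have "finite (R' \<union> (\<Union>i<?M. {..h i} \<union> reservoir f (1 - c) R (h i # D)))"
      using fin dead by auto
    ultimately show False using inf finite_subset by blast
  qed
  ultimately have "computable_infinite R'" by (simp add: computable_infinite_def)
  from j[OF this] obtain g where g: "blocks f j ?M (tree_copy f k d (1 - c)) c g" "g ` {..<j * ?M} \<subseteq> R'"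
    by blast
  let ?g = "\<lambda>x. if x < ?M then h x else g (x - ?M)"
  have gR': "g y \<in> R'" if "y < j * ?M" for y using g(2) that by auto
  have "blocks f (Suc j) ?M (tree_copy f k d (1 - c)) c ?g"
  proof (rule blocks_Cons[OF h g(1)])
    show "h x < g y \<and> f (h x) (g y) = c" if "x < ?M" "y < j * ?M" for x y
      using gR'[OF that(2)] that(1) by (auto simp: R'_def reservoir_def)
  qed (rule tree_copy_cong)
  moreover have "?g ` {..<Suc j * ?M} \<subseteq> R"
    using dead gR' by (auto simp: R'_def reservoir_def)
  ultimately show False using Suc_j by blast
qed

theorem theorem5p5:
  fixes f :: "nat \<Rightarrow> nat \<Rightarrow> nat" and l :: nat and \<pi> :: "nat \<Rightarrow> nat" and X :: "nat set"
  assumes "separable l \<pi>"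
    and "coloring f"
    and "computable_coloring f"
    and "avoids f l (perm_pattern \<pi>)"
    and "two_random X"
  shows "\<exists>H. infinite H \<and> homogeneous f H \<and> computes X H"
proof -
  \<comment> \<open>Patterns and homogeneity look only at increasing pairs, where the total
    \<open>g\<close> agrees with \<open>f\<close>.\<close>
  obtain g where g: "recursive_in {} (\<lambda>m. g (pfst m) (psnd m))" "\<And>x y. x < y \<Longrightarrow> g x y = f x y"
    using computable_coloring_total[OF assms(3)] by blast
  have g01: "g x y \<in> {0, 1}" if "x < y" for x y
    using assms(2) g(2)[OF that] that by (auto simp: coloring_def)
  have "realizes g F l p \<longleftrightarrow> realizes f F l p" for F p
  proof -
    have "g (sorted_list_of_set F ! i) (sorted_list_of_set F ! j) =
        f (sorted_list_of_set F ! i) (sorted_list_of_set F ! j)"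
      if "i < j" "j < l" "card F = l" "finite F" for i j
      using that strict_sorted_list_of_set[of F] by (intro g(2)) (simp add: sorted_wrt_nth_less)
    then show ?thesis unfolding realizes_def by metis
  qed
  then have "avoids g l (perm_pattern \<pi>)" using assms(4) by (simp add: avoids_def)
  then obtain d0 where "\<And>h. \<not> tree_copy g 2 d0 0 h"
    using avoids_separable_no_tree_copy[OF assms(1)] by blast
  from minimal_avoided_structure[OF this] obtain d k c j R where
    c: "c \<in> {0, 1}" and R: "computable_infinite R"
    and tree: "\<And>R' N c'. computable_infinite R' \<Longrightarrow> c' \<in> {0, 1} \<Longrightarrow>
      \<exists>h. tree_copy g N d c' h \<and> h ` {..<N ^ d} \<subseteq> R'"
    and j: "\<And>R'. computable_infinite R' \<Longrightarrow>
       \<exists>h. blocks g j (k ^ d) (tree_copy g k d (1 - c)) c h \<and> h ` {..<j * k ^ d} \<subseteq> R'"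
    and Suc_j: "\<And>h. blocks g (Suc j) (k ^ d) (tree_copy g k d (1 - c)) c h \<Longrightarrow> \<not> h ` {..<Suc j * k ^ d} \<subseteq> R"
    by metis
  \<comment> \<open>The choice \<open>q = d * k\<close> works because
    \<open>n \<le> 2 ^ n\<close>.\<close>
  interpret sparse_walk g R "1 - c" d "d * k" k
  proof
    show "infinite R" "decidable_in {} (\<lambda>y. y \<in> R)" using R by (simp_all add: computable_infinite_def)
    show "\<exists>h. tree_copy g N d (1 - c) h \<and> h ` {..<N ^ d} \<subseteq> R'" if "computable_infinite R'" for R' N
      using tree[OF that, of "1 - c" N] c by auto
    show False if "infinite (reservoir g (1 - c) R D)" "tree_copy g k d (1 - c) h"
      "\<And>i. i < k ^ d \<Longrightarrow> h i \<in> reservoir g (1 - c) R D \<and> finite (reservoir g (1 - c) R (h i # D))" for D h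
      using dead_ends_contain_no_tree_copy[OF g(1) g01 c R j Suc_j that] .
    show "d * k \<le> 2 ^ (d * k)" using less_exp[of "d * k"] by simp
  qed (rule g(1))
  obtain H where "infinite H" "\<forall>x\<in>H. \<forall>y\<in>H. x < y \<longrightarrow> g x y = 1 - c" "computes X H"
    using two_random_computes_homogeneous[OF assms(5)] by blast
  then show ?thesis using g(2) unfolding homogeneous_def by metis
qed

end
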